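(* Consider the distributed stochastic approximation scheme described in the context, with iterates $\{x_k\}$. Assume: (1) the sets $X_i\subseteq\mathbb{R}^{n_i}$, $i=1,\dots,N$, are closed and convex, and the mapping $F$ is strongly monotone with constant $\eta>0$ and Lipschitz continuous with constant $L$ over $X=\prod_{i=1}^N X_i$; (2) the stepsizes satisfy $\gamma_{k,i}>0$ for all $k$ and $i$, with $\sum_{k=0}^\infty\gamma_{k,i}=\infty$ and $\sum_{k=0}^\infty\gamma_{k,i}^2<\infty$ for every $i$; and there is a scalar $\beta$ with $0\le\beta<\frac{\eta}{L}$ such that $\frac{\Gamma_k-\delta_k}{\delta_k}\le\beta$ for all $k\ge0$, where $\{\delta_k\}$ and $\{\Gamma_k\}$ are fixed positive (deterministic) sequences satisfying $\delta_k\le\min_{i=1,\dots,N}\gamma_{k,i}$ and $\Gamma_k\ge\max_{i=1,\dots,N}\gamma_{k,i}$ for all $k\ge0$; (3) there is a constant $\nu>0$ such that $\mathsf{E}[\|w_k\|^2\mid\mathcal{F}_k]\le\nu^2$ almost surely for all $k\ge0$. Let $x^*$ denote the unique solution of VI$(X,F)$. Then: (a) The following relation holds (almost surely) for all $k\ge0$: $$\mathsf{E}[\|x_{k+1}-x^*\|^2]\le(1+\beta)^2\delta_k^2\nu^2+\bigl(1-2(\eta-\beta L)\delta_k+(1+\beta)^2L^2\delta_k^2\bigr)\,\mathsf{E}[\|x_k-x^*\|^2].$$ (b) The sequence $\{x_k\}$ converges almost surely to the unique solution $x^*$ of VI$(X,F)$.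
   Context: Setting. There are $N$ players; player $i$ chooses $x_i\in X_i\subseteq\mathbb{R}^{n_i}$ to minimize $\mathsf{E}[f_i(x_i,x_{-i},\xi_i)]$, where $\xi_i$ is a random vector and $x_{-i}=\{x_j:j\ne i\}$; this expected cost is strongly convex in $x_i$ for all $x_{-i}\in\prod_{j\neq i}X_j$. Put $n=\sum_i n_i$, $X=\prod_{i=1}^N X_i\subseteq\mathbb{R}^n$, $x=(x_1,\dots,x_N)$, $\hat F(x,\xi)=(\nabla_{x_1}f_1(x,\xi_1),\dots,\nabla_{x_N}f_N(x,\xi_N))$ with $\xi=(\xi_1,\dots,\xi_N)$, and $F(x)=(F_1(x),\dots,F_N(x))$ with $F_i(x)=\nabla_{x_i}\mathsf{E}[f_i(x,\xi_i)]=\mathsf{E}[\nabla_{x_i}f_i(x,\xi_i)]$. A vector $x^*\in X$ solves VI$(X,F)$ if $(x-x^* )^TF(x^* )\ge0$ for all $x\in X$; its solutions characterize the equilibria of the game. Norm: $\|\cdot\|$ is Euclidean; $\Pi_{X_i}$ is the Euclidean projection onto $X_i$. $F$ is strongly monotone on $X$ with constant $\eta$ if $(F(x)-F(y))^T(x-y)\ge\eta\|x-y\|^2$ for all $x,y\in X$, and Lipschitz with constant $L$ if $\|F(x)-F(y)\|\le L\|x-y\|$ for all $x,y\in X$. Scheme. For $k\ge0$ and $i=1,\dots,N$, $$x_{k+1,i}=\Pi_{X_i}\bigl(x_{k,i}-\gamma_{k,i}(F_i(x_k)+w_{k,i})\bigr),\qquad w_{k,i}=\hat F_i(x_k,\xi_k)-F_i(x_k),$$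 where $\gamma_{k,i}>0$ is the deterministic stepsize of player $i$ at iteration $k$, $x_k=(x_{k,1},\dots,x_{k,N})$, $w_k=(w_{k,1},\dots,w_{k,N})$, and $\xi_k=(\xi_{k,1},\dots,\xi_{k,N})$ is the sample of $\xi$ at iteration $k$. The initial vector $x_0\in X$ is random, independent of the samples, with $\mathsf{E}[\|x_0\|^2]<\infty$. The history is $\mathcal{F}_0=\{x_0\}$ and $\mathcal{F}_k=\{x_0,\xi_0,\dots,\xi_{k-1}\}$ for $k\ge1$ (conditioning on $\mathcal{F}_k$ means on the generated $\sigma$-algebra). The errors satisfy $\mathsf{E}[w_{k,i}\mid\mathcal{F}_k]=0$ for all $k,i$. *)

theory Defs
  imports "HOL-Probability.Probability"
begin

text \<open>
  The joint strategy space is \<open>real ^ 'n\<close>, its coordinates being distributed among the players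
  (the finite type \<open>'p\<close>) by a map \<open>own :: 'n \<Rightarrow> 'p\<close>; player \<open>i\<close> controls
  \<open>card {j. own j = i}\<close> coordinates.  The strategy space of player \<open>i\<close> is represented
  isometrically by the coordinate subspace \<open>block_space own i\<close> of \<open>real ^ 'n\<close>, i.e. vectors of
  player \<open>i\<close> are padded with zeros.
\<close>

definition block_space :: "('n::finite \<Rightarrow> 'p) \<Rightarrow> 'p \<Rightarrow> (real ^ 'n) set" where
  "block_space own i = {v. \<forall>j. own j \<noteq> i \<longrightarrow> v $ j = 0}"

definition block :: "('n::finite \<Rightarrow> 'p) \<Rightarrow> 'p \<Rightarrow> real ^ 'n \<Rightarrow> real ^ 'n" where
  "block own i x = (\<chi> j. if own j = i then x $ j else 0)"

text \<open>The vector \<open>(u, x\<^sub>-\<^sub>i)\<close>, for \<open>u\<close> in \<open>block_space own i\<close>.\<close>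

definition replace_block :: "('n::finite \<Rightarrow> 'p) \<Rightarrow> 'p \<Rightarrow> real ^ 'n \<Rightarrow> real ^ 'n \<Rightarrow> real ^ 'n" where
  "replace_block own i u x = (x - block own i x) + u"

definition joint_set :: "('n::finite \<Rightarrow> 'p) \<Rightarrow> ('p \<Rightarrow> (real ^ 'n) set) \<Rightarrow> (real ^ 'n) set" where
  "joint_set own Xs = {x. \<forall>i. block own i x \<in> Xs i}"

text \<open>
  Partial gradients.  The derivative is taken within the subspace \<open>block_space own i\<close>,
  which amounts to an unrestricted derivative with respect to the coordinates of player \<open>i\<close>;
  since \<open>g\<close> lies in that subspace, it is unique.
\<close>

definition has_block_gradient ::
  "('n::finite \<Rightarrow> 'p) \<Rightarrow> 'p \<Rightarrow> (real ^ 'n \<Rightarrow> real) \<Rightarrow> real ^ 'n \<Rightarrow> real ^ 'n \<Rightarrow> bool" where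
  "has_block_gradient own i \<phi> x g \<longleftrightarrow>
     g \<in> block_space own i \<and>
     ((\<lambda>u. \<phi> (replace_block own i u x)) has_derivative (\<lambda>h. g \<bullet> h))
       (at (block own i x) within block_space own i)"

definition block_differentiable ::
  "('n::finite \<Rightarrow> 'p) \<Rightarrow> 'p \<Rightarrow> (real ^ 'n \<Rightarrow> real) \<Rightarrow> real ^ 'n \<Rightarrow> bool" where
  "block_differentiable own i \<phi> x \<longleftrightarrow> (\<exists>g. has_block_gradient own i \<phi> x g)"

definition block_gradient ::
  "('n::finite \<Rightarrow> 'p) \<Rightarrow> 'p \<Rightarrow> (real ^ 'n \<Rightarrow> real) \<Rightarrow> real ^ 'n \<Rightarrow> real ^ 'n" where
  "block_gradient own i \<phi> x = (THE g. has_block_gradient own i \<phi> x g)"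

text \<open>
  The stacked vector of the gradients of \<open>\<phi> i\<close> with respect to the block of player \<open>i\<close>; as the
  blocks are zero-padded, stacking is summation.
\<close>

definition stacked_gradient ::
  "('n::finite \<Rightarrow> 'p::finite) \<Rightarrow> ('p \<Rightarrow> real ^ 'n \<Rightarrow> real) \<Rightarrow> real ^ 'n \<Rightarrow> real ^ 'n" where
  "stacked_gradient own \<phi> x = (\<Sum>i\<in>UNIV. block_gradient own i (\<phi> i) x)"

definition strongly_convex_on :: "'a::real_normed_vector set \<Rightarrow> ('a \<Rightarrow> real) \<Rightarrow> bool" where
  "strongly_convex_on S \<phi> \<longleftrightarrow>
     (\<exists>\<mu>>0. \<forall>x\<in>S. \<forall>y\<in>S. \<forall>t\<in>{0..1}.
        \<phi> ((1 - t) *\<^sub>R x + t *\<^sub>R y)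
          \<le> (1 - t) * \<phi> x + t * \<phi> y - \<mu> / 2 * t * (1 - t) * (norm (x - y))\<^sup>2)"

definition strongly_monotone_on :: "real \<Rightarrow> 'a::real_inner set \<Rightarrow> ('a \<Rightarrow> 'a) \<Rightarrow> bool" where
  "strongly_monotone_on \<eta> X F \<longleftrightarrow>
     (\<forall>x\<in>X. \<forall>y\<in>X. (F x - F y) \<bullet> (x - y) \<ge> \<eta> * (norm (x - y))\<^sup>2)"

definition solves_VI :: "'a::real_inner set \<Rightarrow> ('a \<Rightarrow> 'a) \<Rightarrow> 'a \<Rightarrow> bool" where
  "solves_VI X F z \<longleftrightarrow> z \<in> X \<and> (\<forall>x\<in>X. (x - z) \<bullet> F z \<ge> 0)"

text \<open>The \<open>\<sigma>\<close>-algebra on \<open>space M\<close> generated by \<open>x0\<close> and \<open>\<xi> 0, \<dots>, \<xi> (k - 1)\<close>.\<close>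

definition history ::
  "'w measure \<Rightarrow> ('w \<Rightarrow> 'a::topological_space) \<Rightarrow> 'b measure \<Rightarrow> (nat \<Rightarrow> 'w \<Rightarrow> 'b) \<Rightarrow> nat \<Rightarrow> 'w measure"
where
  "history M x0 B \<xi> k =
     sigma (space M)
       ({x0 -` A \<inter> space M | A. A \<in> sets borel} \<union>
        (\<Union>j<k. {\<xi> j -` A \<inter> space M | A. A \<in> sets B}))"

end

theory Submission
  imports Defs
begin

text \<open>
  The projected step contracts towards the solution \<open>x\<^sup>*\<close> of the variational inequality: players
  with unequal stepsizes perturb the gradient step with the common stepsize \<open>\<delta> k\<close> by at most
  \<open>\<beta> * L * \<delta> k\<close>, which is less than the gain \<open>\<eta> * \<delta> k\<close> from strong monotonicity, and the noise is
  orthogonal to the history and contributes only its variance.  Taking this estimate on every event of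
  the history shows that the squared distance to \<open>x\<^sup>*\<close> is a nonnegative supermartingale up to summable
  errors.  As the stepsizes are not summable, its expectation tends to zero, and Doob's maximal
  inequality improves this to almost sure convergence, without the full martingale convergence theorem.
\<close>

text \<open>With unequal stepsizes the scheme is not the projection of one scaled gradient step.
  What rescues \<open>x\<^sup>*\<close> as a fixed point is that \<open>X\<close> is a product: the
  variational inequality splits into one inequality per player, so each block of
  \<open>x\<^sup>*\<close> is fixed by that player's projected step, whatever the positive stepsize.
  Nonexpansiveness of the projections then bounds the new error by the unprojected one. Both
  constants come from \<delta> \<le> \<gamma> \<le> (1 + \<beta>) \<delta>, which the ratio
  condition gives: the excess \<gamma> - \<delta> \<le> \<beta> \<delta> enters the inner product
  and yields \<beta> L, while the full stepsize (1 + \<beta>) \<delta> enters the squared terms. An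
  inequality between integrals over all events of the history is the conditional inequality, stated
  without a conditional expectation of the squared distance; the event \<open>space M\<close> gives
  (a). For (b), the quadratic term can push the factor in (a) above 1. It is summable, so dividing
  by the bounded products of 1 + p absorbs it. The linear term serves only to drive the expectation
  to zero; a supermartingale remains without it.\<close>

section \<open>A deterministic recursion with summable perturbations\<close>

lemma prod_one_plus_bounded:
  fixes p :: "nat \<Rightarrow> real"
  assumes "\<And>k. 0 \<le> p k" and "summable p"
  shows "(\<Prod>j<k. 1 + p j) \<le> exp (suminf p)"
proof -
  have "(\<Prod>j<k. 1 + p j) \<le> (\<Prod>j<k. exp (p j))"
    using assms(1) by (intro prod_mono) (auto simp: add_nonneg_nonneg)
  also have "\<dots> = exp (\<Sum>j<k. p j)"
    by (simp add: exp_sum)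
  also have "\<dots> \<le> exp (suminf p)"
    using assms by (simp add: sum_le_suminf)
  finally show ?thesis .
qed

text \<open>Normalising by the products of \<open>1 + p j\<close> and adding the tail of
  \<open>q\<close> gives a decreasing sequence whose total decrease bounds the sum of the terms
  \<open>d k * e k / P (Suc k)\<close>. The factor \<open>1 + p k - d k\<close> may be negative, so
  only \<open>1 + p k\<close> is divided out and \<open>d k\<close> is kept as a decrement.\<close>

lemma recursive_decay:
  fixes e d p q :: "nat \<Rightarrow> real"
  assumes e: "\<And>k. 0 \<le> e k" and d: "\<And>k. 0 \<le> d k" "\<not> summable d"
    and p: "\<And>k. 0 \<le> p k" "summable p" and q: "\<And>k. 0 \<le> q k" "summable q"
    and rec: "\<And>k. e (Suc k) \<le> (1 + p k - d k) * e k + q k"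
  shows "e \<longlonglongrightarrow> 0"
proof -
  define P where "P = (\<lambda>k. \<Prod>j<k. 1 + p j)"
  define T where "T = (\<lambda>k. suminf q - (\<Sum>j<k. q j))"
  define y where "y = (\<lambda>k. e k / P k + T k)"
  define B where "B = exp (suminf p)"
  have P1: "1 \<le> P k" for k
    unfolding P_def using p(1) by (intro prod_ge_1) auto
  have PB: "P k \<le> B" for k
    unfolding P_def B_def using p by (rule prod_one_plus_bounded)
  have PS: "P (Suc k) = P k * (1 + p k)" for k
    by (simp add: P_def)
  have T0: "0 \<le> T k" for k
    unfolding T_def using q by (simp add: sum_le_suminf)
  have "T \<longlonglongrightarrow> suminf q - suminf q"
    unfolding T_def by (intro tendsto_diff tendsto_const summable_LIMSEQ q)
  then have T_lim: "T \<longlonglongrightarrow> 0"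
    by simp
  have step: "y (Suc k) + d k * e k / P (Suc k) \<le> y k" for k
  proof -
    have "e (Suc k) / P (Suc k) \<le> ((1 + p k - d k) * e k + q k) / P (Suc k)"
      using rec[of k] P1[of "Suc k"] by (intro divide_right_mono) auto
    also have "\<dots> = (1 + p k) * e k / P (Suc k) - d k * e k / P (Suc k) + q k / P (Suc k)"
      by (simp add: add_divide_distrib diff_divide_distrib algebra_simps)
    also have "(1 + p k) * e k / P (Suc k) = e k / P k"
      unfolding PS using p(1)[of k] by simp
    also have "q k / P (Suc k) \<le> q k"
      using q(1)[of k] P1[of "Suc k"] divide_left_mono[of 1 "P (Suc k)" "q k"] by simp
    finally show ?thesis
      by (simp add: y_def T_def)
  qed
  have gain: "0 \<le> d k * e k / P (Suc k)" for k
    using d(1)[of k] e[of k] P1[of "Suc k"] by simp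
  have y0: "0 \<le> y k" for k
    using e[of k] P1[of k] T0[of k] by (simp add: y_def)
  have "decseq y"
  proof (rule decseq_SucI)
    show "y (Suc k) \<le> y k" for k
      using step[of k] gain[of k] by linarith
  qed
  then obtain l where l: "y \<longlonglongrightarrow> l"
    using decseq_convergent y0 by blast
  have "(\<lambda>k. y k - T k) \<longlonglongrightarrow> l - 0"
    by (intro tendsto_diff l T_lim)
  then have eP: "(\<lambda>k. e k / P k) \<longlonglongrightarrow> l"
    by (simp add: y_def)
  have eP0: "0 \<le> e k / P k" for k
    using e[of k] P1[of k] by simp
  then have l0: "0 \<le> l"
    by (intro LIMSEQ_le_const[OF eP]) auto
  have telescope: "(\<Sum>k<n. d k * e k / P (Suc k)) \<le> y 0 - y n" for n
  proof (induction n)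
    case (Suc n)
    then show ?case using step[of n] by simp
  qed simp
  have partial: "(\<Sum>k<n. d k * e k / P (Suc k)) \<le> y 0" for n
    using telescope[of n] y0[of n] by linarith
  have summ: "summable (\<lambda>k. d k * e k / P (Suc k))"
    using gain partial by (rule summableI_nonneg_bounded)
  \<comment> \<open>A positive limit would keep \<open>e\<close> eventually above
    \<open>l / 2\<close>; as \<open>P\<close> is bounded by \<open>B\<close>, a multiple of the
    summable decrements would then dominate \<open>d\<close>.\<close>
  have "l = 0"
  proof (rule ccontr)
    assume "l \<noteq> 0"
    then have "l / 2 < l" "0 < l" using l0 by auto
    then obtain N where N: "\<And>n. n \<ge> N \<Longrightarrow> l / 2 < e n / P n"
      using order_tendstoD(1)[OF eP, of "l / 2"] by (auto simp: eventually_sequentially)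
    have "summable d"
    proof (rule summable_comparison_test')
      show "summable (\<lambda>k. 2 * B / l * (d k * e k / P (Suc k)))"
        by (intro summable_mult summ)
      fix n assume "n \<ge> N"
      have "e n / P n \<le> e n"
        using P1[of n] e[of n] mult_left_mono[of 1 "P n" "e n"] by (simp add: divide_le_eq)
      then have en: "l / 2 \<le> e n"
        using N[OF \<open>n \<ge> N\<close>] by linarith
      define Z where "Z = d n * e n / P (Suc n)"
      have "d n * (l / 2) / B \<le> Z"
        unfolding Z_def
      proof (rule frac_le)
        show "d n * (l / 2) \<le> d n * e n"
          using d(1) en by (rule mult_left_mono[rotated])
        show "0 \<le> d n * e n" "0 < P (Suc n)" "P (Suc n) \<le> B"
          using d(1)[of n] e[of n] P1[of "Suc n"] PB by auto
      qed
      moreover have "0 < B" by (simp add: B_def)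
      ultimately have "d n \<le> 2 * B / l * Z"
        using \<open>0 < l\<close> by (simp add: field_simps)
      then show "norm (d n) \<le> 2 * B / l * (d n * e n / P (Suc n))"
        unfolding Z_def using d(1)[of n] by simp
    qed
    with d(2) show False ..
  qed
  then have "(\<lambda>k. B * (e k / P k)) \<longlonglongrightarrow> 0"
    using tendsto_mult[OF tendsto_const eP, of B] by simp
  moreover have "e k \<le> B * (e k / P k)" for k
  proof -
    have "e k = P k * (e k / P k)"
      using P1[of k] by simp
    also have "\<dots> \<le> B * (e k / P k)"
      using eP0 PB by (rule mult_right_mono[rotated])
    finally show ?thesis .
  qed
  ultimately show ?thesis
    using e by (intro tendsto_sandwich[of "\<lambda>_. 0" e sequentially "\<lambda>k. B * (e k / P k)" 0] always_eventually) simp_all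
qed

section \<open>Nonnegative supermartingales whose expectations vanish in the limit\<close>

text \<open>
  Stopping at the first exceedance after time \<open>n\<close> gives Doob's maximal inequality.
\<close>

lemma (in prob_space) supermartingale_maximal:
  fixes U :: "nat \<Rightarrow> 'a \<Rightarrow> real"
  assumes sub: "\<And>k. subalgebra M (G k)" and mono: "\<And>k. sets (G k) \<subseteq> sets (G (Suc k))"
    and meas: "\<And>k. U k \<in> borel_measurable (G k)" and int: "\<And>k. integrable M (U k)"
    and nonneg: "\<And>k \<omega>. \<omega> \<in> space M \<Longrightarrow> 0 \<le> U k \<omega>"
    and decr: "\<And>k A. A \<in> sets (G k) \<Longrightarrow> (LINT \<omega>:A|M. U (Suc k) \<omega>) \<le> (LINT \<omega>:A|M. U k \<omega>)"
  shows "\<epsilon> * prob {\<omega>\<in>space M. \<exists>k\<ge>n. \<epsilon> \<le> U k \<omega>} \<le> expectation (U n)"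
proof -
  define B where "B = (\<lambda>m. {\<omega>\<in>space M. \<exists>k\<in>{n..<n+m}. \<epsilon> \<le> U k \<omega>})"
  have spG: "space (G k) = space M" and setsGM: "sets (G k) \<subseteq> sets M" for k
    using sub[of k] by (auto simp: subalgebra_def)
  have G_mono: "sets (G i) \<subseteq> sets (G j)" if "i \<le> j" for i j
    using that by (rule lift_Suc_mono_le[of "\<lambda>k. sets (G k)", OF mono])
  have level: "{\<omega>\<in>space M. \<epsilon> \<le> U k \<omega>} \<in> sets (G k)" for k
    using meas[of k] spG[of k] by (metis borel_measurable_iff_ge)
  have Bset: "B m \<in> sets (G (n + m))" for m
  proof -
    have "B m = (\<Union>k\<in>{n..<n+m}. {\<omega>\<in>space M. \<epsilon> \<le> U k \<omega>})"
      by (auto simp: B_def)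
    also have "\<dots> \<in> sets (G (n + m))"
      using level G_mono by (intro sets.finite_UN) (auto, meson G_mono less_imp_le subsetD)
    finally show ?thesis .
  qed
  have BM: "B m \<in> sets M" for m
    using Bset setsGM by blast
  have sint: "set_integrable M A (U k)" if "A \<in> sets M" for A k
    unfolding set_integrable_def using that int by (rule integrable_mult_indicator)
  \<comment> \<open>The left side is a lower bound for the expectation of the process stopped at its
    first exceedance: on \<open>B m\<close> the stopped value is at least \<epsilon>, and off
    \<open>B m\<close> the process is still running at time \<open>n + m\<close>. Each step of the
    induction splits off the outcomes that stop at time \<open>n + m\<close>.\<close>
  have key: "\<epsilon> * prob (B m) + (LINT \<omega>:space M - B m|M. U (n + m) \<omega>) \<le> expectation (U n)" for m
  proof (induction m)
    case 0
    have "B 0 = {}" by (auto simp: B_def)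
    then show ?case
      by (simp add: set_integral_space int)
  next
    case (Suc m)
    define E where "E = {\<omega>\<in>space M - B m. \<epsilon> \<le> U (n + m) \<omega>}"
    have EM: "E \<in> sets M"
    proof -
      have "E = {\<omega>\<in>space M. \<epsilon> \<le> U (n + m) \<omega>} - B m"
        by (auto simp: E_def)
      then show ?thesis
        using level[of "n + m"] setsGM BM[of m] by auto
    qed
    have BS: "B (Suc m) = B m \<union> E" and disj: "B m \<inter> E = {}"
      by (auto simp: B_def E_def less_Suc_eq)
    have split: "space M - B m = (space M - B (Suc m)) \<union> E"
      unfolding BS by (auto simp: E_def)
    have "\<epsilon> * prob (B (Suc m)) = \<epsilon> * prob (B m) + \<epsilon> * prob E"
      unfolding BS using finite_measure_Union[OF BM EM disj] by (simp add: algebra_simps)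
    also have "\<epsilon> * prob E = (LINT \<omega>:E|M. \<epsilon>)"
      using EM by (simp add: set_lebesgue_integral_def mult.commute)
    also have "\<dots> \<le> (LINT \<omega>:E|M. U (n + m) \<omega>)"
    proof (intro set_integral_mono sint EM)
      show "set_integrable M E (\<lambda>\<omega>. \<epsilon>)"
        unfolding set_integrable_def by (intro integrable_mult_indicator EM integrable_const)
    qed (simp add: E_def)
    finally have 1: "\<epsilon> * prob (B (Suc m)) \<le> \<epsilon> * prob (B m) + (LINT \<omega>:E|M. U (n + m) \<omega>)"
      by simp
    \<comment> \<open>Not having stopped up to and including time \<open>n + m\<close> is decided by
      the history at that time, so \<open>decr\<close> may be applied on this event.\<close>
    have "space M - B (Suc m) \<in> sets (G (n + m))"
    proof -
      have "space M - B (Suc m) = {\<omega>\<in>space M. \<not> \<epsilon> \<le> U (n + m) \<omega>} - B m"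
        by (auto simp: BS E_def)
      moreover have "{\<omega>\<in>space M. \<not> \<epsilon> \<le> U (n + m) \<omega>} = space (G (n + m)) - {\<omega>\<in>space M. \<epsilon> \<le> U (n + m) \<omega>}"
        by (auto simp: spG)
      ultimately show ?thesis
        using level[of "n + m"] Bset[of m] by auto
    qed
    from decr[OF this]
    have "(LINT \<omega>:space M - B (Suc m)|M. U (n + Suc m) \<omega>) \<le> (LINT \<omega>:space M - B (Suc m)|M. U (n + m) \<omega>)"
      by simp
    moreover have "(LINT \<omega>:space M - B m|M. U (n + m) \<omega>) =
        (LINT \<omega>:space M - B (Suc m)|M. U (n + m) \<omega>) + (LINT \<omega>:E|M. U (n + m) \<omega>)"
      unfolding split using EM BM
      by (intro set_integral_Un sint) (auto simp: BS)
    ultimately show ?case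
      using Suc.IH 1 by linarith
  qed
  have bound: "\<epsilon> * prob (B m) \<le> expectation (U n)" for m
  proof -
    have "0 \<le> (LINT \<omega>:space M - B m|M. U (n + m) \<omega>)"
      unfolding set_lebesgue_integral_def using nonneg
      by (intro integral_nonneg_AE AE_I2) (auto simp: indicator_def)
    with key[of m] show ?thesis by linarith
  qed
  have "(\<Union>m. B m) = {\<omega>\<in>space M. \<exists>k\<ge>n. \<epsilon> \<le> U k \<omega>}"
  proof (intro equalityI subsetI)
    fix \<omega> assume "\<omega> \<in> {\<omega>\<in>space M. \<exists>k\<ge>n. \<epsilon> \<le> U k \<omega>}"
    then obtain k where "\<omega> \<in> space M" "n \<le> k" "\<epsilon> \<le> U k \<omega>" by blast
    then have "\<omega> \<in> B (Suc k)" by (auto simp: B_def)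
    then show "\<omega> \<in> (\<Union>m. B m)" by blast
  qed (auto simp: B_def)
  moreover have "(\<lambda>m. prob (B m)) \<longlonglongrightarrow> prob (\<Union>m. B m)"
  proof (rule finite_Lim_measure_incseq)
    show "range B \<subseteq> sets M" using BM by blast
    show "incseq B" by (auto simp: incseq_def B_def)
  qed
  ultimately have "(\<lambda>m. \<epsilon> * prob (B m)) \<longlonglongrightarrow> \<epsilon> * prob {\<omega>\<in>space M. \<exists>k\<ge>n. \<epsilon> \<le> U k \<omega>}"
    by (metis tendsto_mult_left)
  then show ?thesis
    by (rule LIMSEQ_le_const2) (use bound in auto)
qed

text \<open>Infinitely many exceedances of a level imply one after every time \<open>n\<close>, so
  the maximal inequality bounds their probability, up to the factor \<epsilon>, by every
  \<open>expectation (U n)\<close>, hence by the limit 0.\<close>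

lemma (in prob_space) supermartingale_AE_null:
  fixes U :: "nat \<Rightarrow> 'a \<Rightarrow> real"
  assumes "\<And>k. subalgebra M (G k)" "\<And>k. sets (G k) \<subseteq> sets (G (Suc k))"
    and "\<And>k. U k \<in> borel_measurable (G k)" and int: "\<And>k. integrable M (U k)"
    and nonneg: "\<And>k \<omega>. \<omega> \<in> space M \<Longrightarrow> 0 \<le> U k \<omega>"
    and "\<And>k A. A \<in> sets (G k) \<Longrightarrow> (LINT \<omega>:A|M. U (Suc k) \<omega>) \<le> (LINT \<omega>:A|M. U k \<omega>)"
    and lim: "(\<lambda>k. expectation (U k)) \<longlonglongrightarrow> 0"
  shows "AE \<omega> in M. (\<lambda>k. U k \<omega>) \<longlonglongrightarrow> 0"
proof -
  have [measurable]: "U k \<in> borel_measurable M" for k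
    using int by blast
  have "AE \<omega> in M. \<not> (\<forall>n. \<exists>k\<ge>n. \<epsilon> \<le> U k \<omega>)" if "0 < \<epsilon>" for \<epsilon>
  proof -
    define N where "N = {\<omega>\<in>space M. \<forall>n. \<exists>k\<ge>n. \<epsilon> \<le> U k \<omega>}"
    have N: "N \<in> sets M"
      unfolding N_def by measurable
    have "\<epsilon> * prob N \<le> expectation (U n)" for n
    proof -
      have "prob N \<le> prob {\<omega>\<in>space M. \<exists>k\<ge>n. \<epsilon> \<le> U k \<omega>}"
        by (intro finite_measure_mono) (auto simp: N_def)
      then have "\<epsilon> * prob N \<le> \<epsilon> * prob {\<omega>\<in>space M. \<exists>k\<ge>n. \<epsilon> \<le> U k \<omega>}"
        using \<open>0 < \<epsilon>\<close> by simp
      also have "\<dots> \<le> expectation (U n)"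
        by (rule supermartingale_maximal[where G = G]) (fact assms)+
      finally show ?thesis .
    qed
    then have "\<epsilon> * prob N \<le> 0"
      using LIMSEQ_le_const[OF lim] by blast
    then have "prob N = 0"
      using \<open>0 < \<epsilon>\<close> by (simp add: mult_le_0_iff measure_le_0_iff)
    then have "N \<in> null_sets M"
      using N by (simp add: emeasure_eq_measure null_setsI)
    then have "AE \<omega> in M. \<omega> \<notin> N"
      by (rule AE_not_in)
    with AE_space show ?thesis
      by eventually_elim (auto simp: N_def)
  qed
  \<comment> \<open>Countably many levels suffice for convergence, which keeps the exceptional set
    null.\<close>
  then have "AE \<omega> in M. \<forall>r::nat. \<not> (\<forall>n. \<exists>k\<ge>n. inverse (real (Suc r)) \<le> U k \<omega>)"
    by (subst AE_all_countable) simp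
  with AE_space show ?thesis
  proof eventually_elim
    case (elim \<omega>)
    show ?case
    proof (rule LIMSEQ_I)
      fix r :: real assume "0 < r"
      then obtain m where "inverse (real (Suc m)) < r"
        using reals_Archimedean by blast
      moreover obtain n where "\<forall>k\<ge>n. U k \<omega> < inverse (real (Suc m))"
        using elim(2)[rule_format, of m] by (meson not_le)
      ultimately have "\<forall>k\<ge>n. norm (U k \<omega> - 0) < r"
        using nonneg[OF elim(1)] by fastforce
      then show "\<exists>n. \<forall>k\<ge>n. norm (U k \<omega> - 0) < r" ..
    qed
  qed
qed

text \<open>
  Dividing by \<open>\<Prod>j<k. 1 + p j\<close> and adding the tail \<open>\<Sum>j\<ge>k. q j\<close> turns \<open>V\<close> into a
  nonnegative supermartingale whose expectations tend to zero.
\<close>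

lemma (in prob_space) almost_supermartingale_AE_null:
  fixes V :: "nat \<Rightarrow> 'a \<Rightarrow> real"
  assumes sub: "\<And>k. subalgebra M (G k)" and mono: "\<And>k. sets (G k) \<subseteq> sets (G (Suc k))"
    and meas: "\<And>k. V k \<in> borel_measurable (G k)" and int: "\<And>k. integrable M (V k)"
    and nonneg: "\<And>k \<omega>. \<omega> \<in> space M \<Longrightarrow> 0 \<le> V k \<omega>"
    and d: "\<And>k. 0 \<le> d k" "\<not> summable d"
    and p: "\<And>k. 0 \<le> p k" "summable p" and q: "\<And>k. 0 \<le> q k" "summable q"
    and rec: "\<And>k A. A \<in> sets (G k) \<Longrightarrow>
      (LINT \<omega>:A|M. V (Suc k) \<omega>) \<le> (1 + p k - d k) * (LINT \<omega>:A|M. V k \<omega>) + q k * prob A"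
  shows "AE \<omega> in M. (\<lambda>k. V k \<omega>) \<longlonglongrightarrow> 0"
proof -
  define P where "P = (\<lambda>k. \<Prod>j<k. 1 + p j)"
  define T where "T = (\<lambda>k. suminf q - (\<Sum>j<k. q j))"
  define U where "U = (\<lambda>k \<omega>. V k \<omega> / P k + T k)"
  define B where "B = exp (suminf p)"
  have P1: "1 \<le> P k" for k
    unfolding P_def using p(1) by (intro prod_ge_1) auto
  have PB: "P k \<le> B" for k
    unfolding P_def B_def using p by (rule prod_one_plus_bounded)
  have PS: "P (Suc k) = P k * (1 + p k)" for k
    by (simp add: P_def)
  have T0: "0 \<le> T k" for k
    unfolding T_def using q by (simp add: sum_le_suminf)
  have "T \<longlonglongrightarrow> suminf q - suminf q"
    unfolding T_def by (intro tendsto_diff tendsto_const summable_LIMSEQ q)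
  then have T_lim: "T \<longlonglongrightarrow> 0"
    by simp
  have setsGM: "sets (G k) \<subseteq> sets M" "space (G k) = space M" for k
    using sub[of k] by (auto simp: subalgebra_def)
  have EV0: "0 \<le> (LINT \<omega>:A|M. V k \<omega>)" for k A
    unfolding set_lebesgue_integral_def using nonneg
    by (intro integral_nonneg_AE AE_I2) (auto simp: indicator_def)
  have EV: "(\<lambda>k. expectation (V k)) \<longlonglongrightarrow> 0"
  proof (rule recursive_decay[OF _ d p q])
    fix k
    show "0 \<le> expectation (V k)"
      using nonneg by (intro integral_nonneg_AE AE_I2) auto
    \<comment> \<open>On the event \<open>space M\<close> the hypothesis becomes the deterministic
      recursion for the expectations.\<close>
    have "space M \<in> sets (G k)"
      using setsGM(2)[of k] by (metis sets.top)
    from rec[OF this] show "expectation (V (Suc k)) \<le> (1 + p k - d k) * expectation (V k) + q k"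
      by (simp add: set_integral_space int prob_space)
  qed
  have U_int: "(LINT \<omega>:A|M. U k \<omega>) = (LINT \<omega>:A|M. V k \<omega>) / P k + T k * prob A"
    if "A \<in> sets M" for A k
  proof -
    have "set_integrable M A (\<lambda>\<omega>. V k \<omega> / P k)" "set_integrable M A (\<lambda>\<omega>. T k)"
      unfolding set_integrable_def using that
      by (intro integrable_mult_indicator integrable_divide_zero int integrable_const; simp)+
    then show ?thesis
      using that unfolding U_def
      by (simp add: set_integral_add set_integral_divide_zero) (simp add: set_lebesgue_integral_def)
  qed
  have "AE \<omega> in M. (\<lambda>k. U k \<omega>) \<longlonglongrightarrow> 0"
  proof (rule supermartingale_AE_null[where G = G, OF sub mono])
    fix k
    show "U k \<in> borel_measurable (G k)"
      unfolding U_def using meas[of k] by measurable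
    show "integrable M (U k)"
      unfolding U_def using int by auto
    show "0 \<le> U k \<omega>" if "\<omega> \<in> space M" for \<omega>
      using nonneg[OF that, of k] P1[of k] T0[of k] by (simp add: U_def)
    fix A assume A: "A \<in> sets (G k)"
    then have AM: "A \<in> sets M" using setsGM by blast
    let ?I = "LINT \<omega>:A|M. V k \<omega>"
    \<comment> \<open>The decrement \<open>d k\<close> is discarded: it has done its work in
      \<open>EV\<close>, and the supermartingale property survives without it.\<close>
    have "(LINT \<omega>:A|M. V (Suc k) \<omega>) \<le> (1 + p k) * ?I + q k * prob A"
      using rec[OF A] mult_nonneg_nonneg[OF d(1)[of k] EV0[of A k]] by (simp add: algebra_simps)
    then have "(LINT \<omega>:A|M. V (Suc k) \<omega>) / P (Suc k) \<le> ((1 + p k) * ?I + q k * prob A) / P (Suc k)"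
      using P1[of "Suc k"] by (intro divide_right_mono) auto
    also have "\<dots> = (1 + p k) * ?I / P (Suc k) + q k * prob A / P (Suc k)"
      by (rule add_divide_distrib)
    also have "(1 + p k) * ?I / P (Suc k) = ?I / P k"
      unfolding PS using p(1)[of k] by simp
    also have "q k * prob A / P (Suc k) \<le> q k * prob A / 1"
      using q(1)[of k] P1[of "Suc k"] by (intro divide_left_mono) auto
    finally show "(LINT \<omega>:A|M. U (Suc k) \<omega>) \<le> (LINT \<omega>:A|M. U k \<omega>)"
      unfolding U_int[OF AM] by (simp add: T_def algebra_simps)
  next
    have "expectation (U k) \<le> expectation (V k) + T k" for k
    proof -
      have "expectation (U k) = expectation (V k) / P k + T k"
        unfolding U_def using int by (simp add: prob_space)
      moreover have "expectation (V k) / P k \<le> expectation (V k) / 1"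
        using P1[of k] nonneg by (intro divide_left_mono integral_nonneg_AE AE_I2) auto
      ultimately show ?thesis by simp
    qed
    moreover have "0 \<le> expectation (U k)" for k
      using nonneg P1[of k] T0[of k] unfolding U_def
      by (intro integral_nonneg_AE AE_I2) (auto intro!: add_nonneg_nonneg divide_nonneg_nonneg)
    moreover have "(\<lambda>k. expectation (V k) + T k) \<longlonglongrightarrow> 0"
      using tendsto_add[OF EV T_lim] by simp
    ultimately show "(\<lambda>k. expectation (U k)) \<longlonglongrightarrow> 0"
      by (intro tendsto_sandwich[of "\<lambda>_. 0" "\<lambda>k. expectation (U k)" sequentially "\<lambda>k. expectation (V k) + T k" 0]
          always_eventually) simp_all
  qed
  with AE_space show ?thesis
  proof eventually_elim
    case (elim \<omega>)
    \<comment> \<open>Undoing the normalisation costs only the constant \<open>B\<close>, because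
      the products stay below it and the tail \<open>T k\<close> is nonnegative.\<close>
    have "V k \<omega> \<le> B * U k \<omega>" for k
    proof -
      have "V k \<omega> = P k * (V k \<omega> / P k)"
        using P1[of k] by simp
      also have "\<dots> \<le> B * U k \<omega>"
        using nonneg[OF elim(1), of k] T0[of k] P1[of k] PB[of k]
        unfolding U_def by (intro mult_mono) auto
      finally show ?thesis .
    qed
    moreover have "(\<lambda>k. B * U k \<omega>) \<longlonglongrightarrow> 0"
      using tendsto_mult[OF tendsto_const elim(2), of B] by simp
    ultimately show ?case
      using nonneg[OF elim(1)]
      by (intro tendsto_sandwich[of "\<lambda>_. 0" "\<lambda>k. V k \<omega>" sequentially "\<lambda>k. B * U k \<omega>" 0] always_eventually) simp_all
  qed
qed

section \<open>Blocks of coordinates and playerwise scaling\<close>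

lemma block_nth [simp]: "block own i v $ j = (if own j = i then v $ j else 0)"
  by (simp add: block_def)

lemma linear_block: "linear (block own i)"
  by (rule linearI) (auto simp: vec_eq_iff)

lemmas block_add = linear_add[OF linear_block]
lemmas block_diff = linear_diff[OF linear_block]

lemma continuous_on_block: "continuous_on A (block own i)"
  using linear_block by (intro linear_continuous_on) (simp flip: linear_conv_bounded_linear)

lemma sum_block:
  fixes own :: "'n::finite \<Rightarrow> 'p::finite"
  shows "(\<Sum>i\<in>UNIV. block own i v) = v"
  by (simp add: vec_eq_iff)

text \<open>Every coordinate has exactly one owner, so the blocks are orthogonal. This reassembles
  the separate projection estimates of the players into one for the joint vector.\<close>

lemma sum_norm_block:
  fixes own :: "'n::finite \<Rightarrow> 'p::finite"
  shows "(\<Sum>i\<in>UNIV. (norm (block own i v))\<^sup>2) = (norm v)\<^sup>2"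
proof -
  have "(\<Sum>i\<in>UNIV. (norm (block own i v))\<^sup>2) =
      (\<Sum>i\<in>UNIV. \<Sum>j\<in>UNIV. if own j = i then v $ j * v $ j else 0)"
    by (intro sum.cong refl) (auto simp: power2_norm_eq_inner inner_vec_def intro!: sum.cong)
  also have "\<dots> = (\<Sum>j\<in>UNIV. \<Sum>i\<in>UNIV. if own j = i then v $ j * v $ j else 0)"
    by (rule sum.swap)
  also have "\<dots> = (norm v)\<^sup>2"
    by (simp add: power2_norm_eq_inner inner_vec_def)
  finally show ?thesis .
qed

lemma joint_set_eq_INT: "joint_set own Xs = (\<Inter>i. block own i -` Xs i)"
  by (auto simp: joint_set_def)

lemma convex_joint_set: "(\<And>i. convex (Xs i)) \<Longrightarrow> convex (joint_set own Xs)"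
  unfolding joint_set_eq_INT by (intro convex_INT convex_linear_vimage linear_block) auto

lemma closed_joint_set: "(\<And>i. closed (Xs i)) \<Longrightarrow> closed (joint_set own Xs)"
  unfolding joint_set_eq_INT
  by (intro closed_INT ballI closed_vimage continuous_on_block)

text \<open>The product structure of the joint set: a unilateral deviation stays feasible, which is
  what lets a variational inequality be tested one player at a time.\<close>

lemma replace_block_in_joint_set:
  assumes "Xs i \<subseteq> block_space own i" and "x \<in> joint_set own Xs" and "u \<in> Xs i"
  shows "replace_block own i u x \<in> joint_set own Xs"
proof -
  have u: "u $ j = 0" if "own j \<noteq> i" for j
    using assms(1,3) that by (auto simp: block_space_def)
  have "block own i (replace_block own i u x) = u"
    using u by (auto simp: vec_eq_iff replace_block_def)
  moreover have "block own j (replace_block own i u x) = block own j x" if "j \<noteq> i" for j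
    using u that by (auto simp: vec_eq_iff replace_block_def)
  ultimately show ?thesis
    using assms(2,3) unfolding joint_set_def by (auto, metis)
qed

text \<open>The block-diagonal matrix of the stepsizes. It makes the steps of all players one
  symmetric linear map, whose deviation from a multiple of the identity measures how unequal the
  stepsizes are.\<close>

definition stretch :: "('n::finite \<Rightarrow> 'p) \<Rightarrow> ('p \<Rightarrow> real) \<Rightarrow> real ^ 'n \<Rightarrow> real ^ 'n" where
  "stretch own g v = (\<chi> j. g (own j) * v $ j)"

lemma stretch_nth [simp]: "stretch own g v $ j = g (own j) * v $ j"
  by (simp add: stretch_def)

lemma linear_stretch: "linear (stretch own g)"
  by (rule linearI) (auto simp: vec_eq_iff algebra_simps)

lemma continuous_on_stretch: "continuous_on A (stretch own g)"
  using linear_stretch by (intro linear_continuous_on) (simp flip: linear_conv_bounded_linear)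

lemma block_stretch: "block own i (stretch own g v) = g i *\<^sub>R block own i v"
  by (auto simp: vec_eq_iff)

lemma inner_stretch: "u \<bullet> stretch own g v = stretch own g u \<bullet> v"
  by (simp add: inner_vec_def algebra_simps)

lemma norm_stretch_le:
  assumes "\<And>i. 0 \<le> g i" and "\<And>i. g i \<le> G"
  shows "norm (stretch own g v) \<le> G * norm v"
proof -
  have "0 \<le> G"
    using assms order_trans by blast
  have "norm (stretch own g v) \<le> norm (G *\<^sub>R v)"
    using assms \<open>0 \<le> G\<close> by (intro norm_le_componentwise_cart) (auto simp: abs_mult intro!: mult_right_mono)
  with \<open>0 \<le> G\<close> show ?thesis by simp
qed

lemma norm_diff_square_eq:
  fixes u v :: "'a::real_inner"
  shows "(norm (u - v))\<^sup>2 = (norm u)\<^sup>2 - 2 * (u \<bullet> v) + (norm v)\<^sup>2"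
  unfolding power2_norm_eq_inner by (simp add: inner_diff inner_commute)

text \<open>
  Splitting \<open>stretch own g = \<delta> + stretch own (g - \<delta>)\<close>: the first part contracts by monotonicity,
  and the second one, due to unequal stepsizes, costs at most \<open>\<beta> * L * \<delta>\<close>.
\<close>

lemma norm_diff_stretch_le:
  fixes u e :: "real ^ 'n::finite"
  assumes inner: "\<eta> * (norm u)\<^sup>2 \<le> u \<bullet> e" and lip: "norm e \<le> L * norm u"
    and g: "\<And>i. \<delta> \<le> g i" "\<And>i. g i \<le> (1 + \<beta>) * \<delta>" and "0 \<le> \<delta>" "0 \<le> \<beta>"
  shows "(norm (u - stretch own g e))\<^sup>2 \<le> (1 - 2 * (\<eta> - \<beta> * L) * \<delta> + (1 + \<beta>)\<^sup>2 * L\<^sup>2 * \<delta>\<^sup>2) * (norm u)\<^sup>2"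
proof -
  define r where "r = stretch own (\<lambda>i. g i - \<delta>) e"
  have split: "stretch own g e = \<delta> *\<^sub>R e + r"
    by (simp add: vec_eq_iff r_def algebra_simps)
  have "norm r \<le> (\<beta> * \<delta>) * norm e"
    unfolding r_def using g by (intro norm_stretch_le) (auto simp: algebra_simps)
  also have "\<dots> \<le> (\<beta> * \<delta>) * (L * norm u)"
    using lip assms(5,6) by (intro mult_left_mono) auto
  finally have r: "norm r \<le> \<beta> * \<delta> * L * norm u"
    by (simp add: mult.assoc)
  have "- (u \<bullet> r) \<le> norm u * norm r"
    using Cauchy_Schwarz_ineq2[of u r] by linarith
  also have "\<dots> \<le> norm u * (\<beta> * \<delta> * L * norm u)"
    using r by (intro mult_left_mono) auto
  finally have ur: "- (u \<bullet> r) \<le> \<beta> * \<delta> * L * (norm u)\<^sup>2"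
    by (simp add: power2_eq_square mult_ac)
  have ue: "\<delta> * (\<eta> * (norm u)\<^sup>2) \<le> \<delta> * (u \<bullet> e)"
    using inner \<open>0 \<le> \<delta>\<close> by (rule mult_left_mono)
  \<comment> \<open>The quadratic term is estimated without splitting, by the largest stepsize; this
    is the origin of the factor \<open>(1 + \<beta>)\<^sup>2\<close>.\<close>
  have "norm (stretch own g e) \<le> (1 + \<beta>) * \<delta> * norm e"
    using g \<open>0 \<le> \<delta>\<close> by (intro norm_stretch_le) (auto intro: order_trans)
  also have "\<dots> \<le> (1 + \<beta>) * \<delta> * (L * norm u)"
    using lip assms(5,6) by (intro mult_left_mono) auto
  finally have "(norm (stretch own g e))\<^sup>2 \<le> ((1 + \<beta>) * \<delta> * (L * norm u))\<^sup>2"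
    by (intro power_mono) auto
  then have s: "(norm (stretch own g e))\<^sup>2 \<le> (1 + \<beta>)\<^sup>2 * L\<^sup>2 * \<delta>\<^sup>2 * (norm u)\<^sup>2"
    by (simp add: power_mult_distrib mult_ac)
  have "(norm (u - stretch own g e))\<^sup>2 =
      (norm u)\<^sup>2 - 2 * (\<delta> * (u \<bullet> e) + u \<bullet> r) + (norm (stretch own g e))\<^sup>2"
    unfolding norm_diff_square_eq by (simp add: split inner_add_right)
  also have "\<dots> \<le> (norm u)\<^sup>2 - 2 * (\<delta> * (\<eta> * (norm u)\<^sup>2) - \<beta> * \<delta> * L * (norm u)\<^sup>2)
      + (1 + \<beta>)\<^sup>2 * L\<^sup>2 * \<delta>\<^sup>2 * (norm u)\<^sup>2"
  proof (intro add_mono diff_mono mult_left_mono order_refl s)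
    show "\<delta> * (\<eta> * (norm u)\<^sup>2) - \<beta> * \<delta> * L * (norm u)\<^sup>2 \<le> \<delta> * (u \<bullet> e) + u \<bullet> r"
      using ue ur by linarith
  qed simp
  also have "\<dots> = (1 - 2 * (\<eta> - \<beta> * L) * \<delta> + (1 + \<beta>)\<^sup>2 * L\<^sup>2 * \<delta>\<^sup>2) * (norm u)\<^sup>2"
    by (simp add: algebra_simps)
  finally show ?thesis .
qed

section \<open>Variational inequalities and projections\<close>

text \<open>In the expansion of the squared distance from \<open>q - c *\<^sub>R g\<close> to
  \<open>z\<close>, the cross term is nonnegative by the inequality, so no point of \<open>S\<close>
  is nearer than \<open>q\<close>. The argument works for every \<open>c \<ge> 0\<close>, hence for
  each player's own stepsize.\<close>

lemma closest_point_VI: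
  fixes S :: "'a::euclidean_space set"
  assumes "convex S" "closed S" "q \<in> S" "0 \<le> c" and VI: "\<And>z. z \<in> S \<Longrightarrow> 0 \<le> (z - q) \<bullet> g"
  shows "closest_point S (q - c *\<^sub>R g) = q"
proof (rule closest_point_unique[symmetric, OF assms(1-3)], rule ballI)
  fix z assume "z \<in> S"
  have "(norm (c *\<^sub>R g))\<^sup>2 \<le> (norm (c *\<^sub>R g))\<^sup>2 + 2 * (c * ((z - q) \<bullet> g)) + (norm (z - q))\<^sup>2"
    using VI[OF \<open>z \<in> S\<close>] \<open>0 \<le> c\<close> by simp
  also have "\<dots> = (norm (c *\<^sub>R g + (z - q)))\<^sup>2"
    unfolding power2_norm_eq_inner by (simp add: inner_add_left inner_add_right inner_commute algebra_simps)
  finally have "norm (c *\<^sub>R g) \<le> norm (c *\<^sub>R g + (z - q))"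
    by (simp add: power2_le_iff_abs_le)
  also have "\<dots> = norm (q - c *\<^sub>R g - z)"
    by (subst norm_minus_cancel[symmetric]) (simp add: algebra_simps)
  finally show "dist (q - c *\<^sub>R g) q \<le> dist (q - c *\<^sub>R g) z"
    by (simp add: dist_norm)
qed

lemma solves_VI_unique:
  assumes "strongly_monotone_on \<eta> X F" "0 < \<eta>" "solves_VI X F y" "solves_VI X F z"
  shows "y = z"
proof -
  have "0 \<le> (z - y) \<bullet> F y" "0 \<le> (y - z) \<bullet> F z" "\<eta> * (norm (y - z))\<^sup>2 \<le> (F y - F z) \<bullet> (y - z)"
    using assms unfolding solves_VI_def strongly_monotone_on_def by auto
  then have "\<eta> * (norm (y - z))\<^sup>2 \<le> 0"
    by (simp add: inner_diff_left inner_diff_right inner_commute)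
  with \<open>0 < \<eta>\<close> show ?thesis
    by (simp add: mult_le_0_iff)
qed

text \<open>A fixed point of the contraction \<open>y \<mapsto> closest_point X (y - t *\<^sub>R F y)\<close>, for small \<open>t\<close>, is a solution.\<close>

lemma solves_VI_exists:
  fixes F :: "'a::euclidean_space \<Rightarrow> 'a"
  assumes X: "convex X" "closed X" "X \<noteq> {}"
    and mono: "strongly_monotone_on \<eta> X F" and "0 < \<eta>" and lip: "L-lipschitz_on X F"
  shows "\<exists>z. solves_VI X F z"
proof -
  \<comment> \<open>The factor 1 - 2 t \<eta> + t^2 L^2 is smallest at t = \<eta> / L^2. Replacing
    L^2 by \<open>s\<close> also covers \<open>L = 0\<close>, keeps
    \<open>1 - \<eta>\<^sup>2 / s\<close> nonnegative without comparing \<eta> with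
    \<open>L\<close>, and still gives a factor below 1.\<close>
  define s where "s = L\<^sup>2 + \<eta>\<^sup>2"
  define t where "t = \<eta> / s"
  define c where "c = sqrt (1 - \<eta>\<^sup>2 / s)"
  have "0 < s"
    using \<open>0 < \<eta>\<close> by (simp add: s_def add_nonneg_pos)
  then have "0 < t" and "0 \<le> 1 - \<eta>\<^sup>2 / s" and "0 < \<eta>\<^sup>2 / s"
    using \<open>0 < \<eta>\<close> by (auto simp: t_def s_def)
  then have c: "0 \<le> c" "c < 1" "c\<^sup>2 = 1 - \<eta>\<^sup>2 / s"
    by (auto simp: c_def)
  have coeff: "1 - 2 * t * \<eta> + t\<^sup>2 * L\<^sup>2 \<le> c\<^sup>2"
  proof -
    have "t\<^sup>2 * L\<^sup>2 \<le> t\<^sup>2 * s"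
      by (intro mult_left_mono) (auto simp: s_def)
    also have "\<dots> = \<eta>\<^sup>2 / s"
      using \<open>0 < s\<close> by (simp add: t_def power2_eq_square)
    finally show ?thesis
      unfolding c(3) by (simp add: t_def power2_eq_square)
  qed
  let ?T = "\<lambda>y. closest_point X (y - t *\<^sub>R F y)"
  have contr: "dist (?T y) (?T z) \<le> c * dist y z" if "y \<in> X" "z \<in> X" for y z
  proof -
    have "norm (F y - F z) \<le> L * norm (y - z)"
      using lipschitz_onD[OF lip that] by (simp add: dist_norm)
    then have "(norm (F y - F z))\<^sup>2 \<le> (L * norm (y - z))\<^sup>2"
      by (rule power_mono) simp
    then have 1: "t\<^sup>2 * (norm (F y - F z))\<^sup>2 \<le> t\<^sup>2 * (L\<^sup>2 * (norm (y - z))\<^sup>2)"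
      by (intro mult_left_mono) (auto simp: power_mult_distrib)
    have "\<eta> * (norm (y - z))\<^sup>2 \<le> (F y - F z) \<bullet> (y - z)"
      using mono that by (simp add: strongly_monotone_on_def)
    then have 2: "t * (\<eta> * (norm (y - z))\<^sup>2) \<le> t * ((y - z) \<bullet> (F y - F z))"
      using \<open>0 < t\<close> by (simp add: inner_commute)
    have "(norm (y - z - t *\<^sub>R (F y - F z)))\<^sup>2 =
        (norm (y - z))\<^sup>2 - 2 * (t * ((y - z) \<bullet> (F y - F z))) + t\<^sup>2 * (norm (F y - F z))\<^sup>2"
      using norm_diff_square_eq[of "y - z" "t *\<^sub>R (F y - F z)"] by (simp add: power_mult_distrib)
    also have "\<dots> \<le> (1 - 2 * t * \<eta> + t\<^sup>2 * L\<^sup>2) * (norm (y - z))\<^sup>2"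
      using 1 2 by (simp add: algebra_simps)
    also have "\<dots> \<le> c\<^sup>2 * (norm (y - z))\<^sup>2"
      using coeff by (rule mult_right_mono) simp
    finally have "(norm (y - z - t *\<^sub>R (F y - F z)))\<^sup>2 \<le> (c * norm (y - z))\<^sup>2"
      by (simp add: power_mult_distrib)
    then have "norm (y - z - t *\<^sub>R (F y - F z)) \<le> c * norm (y - z)"
      by (rule power2_le_imp_le) (simp add: c(1))
    moreover have "dist (?T y) (?T z) \<le> dist (y - t *\<^sub>R F y) (z - t *\<^sub>R F z)"
      using X by (rule closest_point_lipschitz)
    ultimately show ?thesis
      by (simp add: dist_norm algebra_simps)
  qed
  have "\<exists>!y\<in>X. ?T y = y"
    using X contr c closest_point_in_set[OF X(2,3)]
    by (intro Banach_fix[of X c]) (auto simp: complete_eq_closed)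
  then obtain z where z: "z \<in> X" "?T z = z"
    by blast
  have "0 \<le> (y - z) \<bullet> F z" if "y \<in> X" for y
  proof -
    \<comment> \<open>The obtuse angle at a projection, read at a fixed point, is the variational
      inequality multiplied by \<open>t\<close>.\<close>
    have "((z - t *\<^sub>R F z) - ?T z) \<bullet> (y - ?T z) \<le> 0"
      using X(1,2) that by (rule closest_point_dot)
    then have "0 \<le> t * (F z \<bullet> (y - z))"
      by (simp add: z(2) inner_diff_left)
    with \<open>0 < t\<close> show ?thesis
      by (simp add: zero_le_mult_iff inner_commute)
  qed
  with z show ?thesis
    by (auto simp: solves_VI_def)
qed

section \<open>The histories and the moments of the noise\<close>

lemma history_generators:
  "{x0 -` A \<inter> space M | A. A \<in> sets borel} \<union> (\<Union>j<k. {\<xi> j -` A \<inter> space M | A. A \<in> sets B})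
    \<subseteq> Pow (space M)"
  by auto

lemma space_history [simp]: "space (history M x0 B \<xi> k) = space M"
  unfolding history_def by (rule space_measure_of[OF history_generators])

lemma sets_history: "sets (history M x0 B \<xi> k) = sigma_sets (space M)
    ({x0 -` A \<inter> space M | A. A \<in> sets borel} \<union> (\<Union>j<k. {\<xi> j -` A \<inter> space M | A. A \<in> sets B}))"
  unfolding history_def by (rule sets_measure_of[OF history_generators])

lemma subalgebra_history:
  assumes [measurable]: "x0 \<in> borel_measurable M" and xi: "\<And>j. \<xi> j \<in> M \<rightarrow>\<^sub>M B"
  shows "subalgebra M (history M x0 B \<xi> k)"
  unfolding subalgebra_def sets_history space_history
  using xi by (auto intro!: sets.sigma_sets_subset measurable_sets)

lemma history_Suc_mono: "sets (history M x0 B \<xi> k) \<subseteq> sets (history M x0 B \<xi> (Suc k))"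
  unfolding sets_history by (intro sigma_sets_mono' Un_mono UN_mono order_refl) auto

lemma measurable_history_initial: "x0 \<in> borel_measurable (history M x0 B \<xi> k)"
  by (rule measurableI) (auto simp: sets_history)

lemma measurable_history_sample:
  assumes "\<xi> j \<in> M \<rightarrow>\<^sub>M B" "j < k"
  shows "\<xi> j \<in> history M x0 B \<xi> k \<rightarrow>\<^sub>M B"
  using assms measurable_space[OF assms(1)]
  by (intro measurableI) (auto simp: sets_history intro!: sigma_sets.Basic)

text \<open>The variance hypothesis is stated with \<open>nn_cond_exp\<close>, which is meaningful
  before integrability is known, and integrability of the squared noise follows from it. This makes
  the product with \<open>v\<close> integrable, and a factor known from the history can be pulled
  out of the conditional mean, which is zero.\<close>

lemma (in prob_space) noise_moments:
  fixes v w :: "'a \<Rightarrow> real ^ 'n::finite"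
  assumes sub: "subalgebra M G" and A: "A \<in> sets G"
    and v: "v \<in> borel_measurable G" "integrable M (\<lambda>\<omega>. (norm (v \<omega>))\<^sup>2)"
    and w: "w \<in> borel_measurable M"
    and mean: "\<And>j. AE \<omega> in M. real_cond_exp M G (\<lambda>\<omega>. w \<omega> $ j) \<omega> = 0"
    and var: "AE \<omega> in M. nn_cond_exp M G (\<lambda>\<omega>. ennreal ((norm (w \<omega>))\<^sup>2)) \<omega> \<le> ennreal (\<nu>\<^sup>2)"
  shows "integrable M (\<lambda>\<omega>. (norm (w \<omega>))\<^sup>2)" (is ?int_w)
    and "(LINT \<omega>:A|M. (norm (w \<omega>))\<^sup>2) \<le> \<nu>\<^sup>2 * prob A"
    and "integrable M (\<lambda>\<omega>. v \<omega> \<bullet> w \<omega>)"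
    and "(LINT \<omega>:A|M. v \<omega> \<bullet> w \<omega>) = 0"
proof -
  interpret fs: finite_measure_subalgebra M G
    by unfold_locales (rule sub)
  note [measurable] = v(1) w
  have [measurable]: "v \<in> borel_measurable M"
    using measurable_from_subalg[OF sub v(1)] .
  note borel_measurable_nth[measurable]
  have AM: "E \<in> sets M" if "E \<in> sets G" for E
    using that sub by (auto simp: subalgebra_def)
  have nn: "(\<integral>\<^sup>+\<omega>. indicator E \<omega> * ennreal ((norm (w \<omega>))\<^sup>2) \<partial>M) \<le> ennreal (\<nu>\<^sup>2 * prob E)"
    if E: "E \<in> sets G" for E
  proof -
    have "(\<integral>\<^sup>+\<omega>. indicator E \<omega> * ennreal ((norm (w \<omega>))\<^sup>2) \<partial>M) =
        (\<integral>\<^sup>+\<omega>. indicator E \<omega> * nn_cond_exp M G (\<lambda>\<omega>. ennreal ((norm (w \<omega>))\<^sup>2)) \<omega> \<partial>M)"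
      using E by (intro fs.nn_cond_exp_intg[symmetric]) auto
    also have "\<dots> \<le> (\<integral>\<^sup>+\<omega>. ennreal (\<nu>\<^sup>2) * indicator E \<omega> \<partial>M)"
      using var by (intro nn_integral_mono_AE) (auto simp: indicator_def)
    also have "\<dots> = ennreal (\<nu>\<^sup>2 * prob E)"
      using AM[OF E] by (simp add: nn_integral_cmult_indicator emeasure_eq_measure ennreal_mult)
    finally show ?thesis .
  qed
  have "space M \<in> sets G"
    using sub sets.top[of G] by (simp add: subalgebra_def)
  from nn[OF this] have "(\<integral>\<^sup>+\<omega>. ennreal ((norm (w \<omega>))\<^sup>2) \<partial>M) \<le> ennreal (\<nu>\<^sup>2 * prob (space M))"
    by (simp cong: nn_integral_cong)
  then show int_w: ?int_w
    by (intro integrableI_bounded) (auto simp: top.extremum_strict le_less_trans)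
  show "(LINT \<omega>:A|M. (norm (w \<omega>))\<^sup>2) \<le> \<nu>\<^sup>2 * prob A"
  proof -
    have "ennreal (LINT \<omega>:A|M. (norm (w \<omega>))\<^sup>2) = (\<integral>\<^sup>+\<omega>. ennreal (indicator A \<omega> *\<^sub>R (norm (w \<omega>))\<^sup>2) \<partial>M)"
      unfolding set_lebesgue_integral_def using AM[OF A]
      by (intro nn_integral_eq_integral[symmetric] integrable_mult_indicator int_w) auto
    also have "\<dots> = (\<integral>\<^sup>+\<omega>. indicator A \<omega> * ennreal ((norm (w \<omega>))\<^sup>2) \<partial>M)"
      by (intro nn_integral_cong) (simp add: indicator_def)
    also have "\<dots> \<le> ennreal (\<nu>\<^sup>2 * prob A)"
      by (rule nn[OF A])
    finally show ?thesis
      by (simp add: ennreal_le_iff)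
  qed
  \<comment> \<open>The factor \<open>f\<close> is there for two uses: the constant 1 for the whole
    inner product, and the indicator of \<open>A\<close> for its integral over an event.\<close>
  have dominated: "integrable M (\<lambda>\<omega>. f \<omega> * (v \<omega> $ j * w \<omega> $ j))"
    if [measurable]: "f \<in> borel_measurable M" and f: "\<And>\<omega>. \<bar>f \<omega>\<bar> \<le> 1" for f j
  proof (rule Bochner_Integration.integrable_bound)
    show "integrable M (\<lambda>\<omega>. (norm (v \<omega>))\<^sup>2 + (norm (w \<omega>))\<^sup>2)"
      using v(2) int_w by simp
    show "(\<lambda>\<omega>. f \<omega> * (v \<omega> $ j * w \<omega> $ j)) \<in> borel_measurable M"
      by measurable
    show "AE \<omega> in M. norm (f \<omega> * (v \<omega> $ j * w \<omega> $ j)) \<le> norm ((norm (v \<omega>))\<^sup>2 + (norm (w \<omega>))\<^sup>2)"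
    proof (rule AE_I2)
      fix \<omega>
      have "\<bar>f \<omega> * (v \<omega> $ j * w \<omega> $ j)\<bar> \<le> 1 * (norm (v \<omega>) * norm (w \<omega>))"
        unfolding abs_mult using f by (intro mult_mono component_le_norm_cart) auto
      also have "\<dots> \<le> (norm (v \<omega>))\<^sup>2 + (norm (w \<omega>))\<^sup>2"
        using sum_squares_bound[of "norm (v \<omega>)" "norm (w \<omega>)"]
          mult_nonneg_nonneg[OF norm_ge_zero norm_ge_zero, of "v \<omega>" "w \<omega>"] by linarith
      finally show "norm (f \<omega> * (v \<omega> $ j * w \<omega> $ j)) \<le> norm ((norm (v \<omega>))\<^sup>2 + (norm (w \<omega>))\<^sup>2)"
        by simp
    qed
  qed
  from dominated[of "\<lambda>_. 1"] show "integrable M (\<lambda>\<omega>. v \<omega> \<bullet> w \<omega>)"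
    by (simp add: inner_vec_def)
  have dom_A: "integrable M (\<lambda>\<omega>. (indicator A \<omega> * v \<omega> $ j) * w \<omega> $ j)" for j
    using dominated[of "indicator A"] AM[OF A] by (simp add: mult.assoc)
  \<comment> \<open>The indicator of \<open>A\<close> joins \<open>v\<close> in the factor known
    from the history, so restricting to the event costs nothing.\<close>
  have zero: "(\<integral>\<omega>. (indicator A \<omega> * v \<omega> $ j) * w \<omega> $ j \<partial>M) = 0" for j
  proof -
    have "(\<integral>\<omega>. (indicator A \<omega> * v \<omega> $ j) * w \<omega> $ j \<partial>M) =
        (\<integral>\<omega>. (indicator A \<omega> * v \<omega> $ j) * real_cond_exp M G (\<lambda>\<omega>. w \<omega> $ j) \<omega> \<partial>M)"
      using A by (intro fs.real_cond_exp_intg(2)[symmetric] dom_A) auto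
    also have "\<dots> = 0"
      using mean[of j] by (intro integral_eq_zero_AE) auto
    finally show ?thesis .
  qed
  have "(LINT \<omega>:A|M. v \<omega> \<bullet> w \<omega>) = (\<integral>\<omega>. (\<Sum>j\<in>UNIV. (indicator A \<omega> * v \<omega> $ j) * w \<omega> $ j) \<partial>M)"
    unfolding set_lebesgue_integral_def inner_vec_def by (simp add: sum_distrib_left mult.assoc)
  also have "\<dots> = 0"
    by (simp add: Bochner_Integration.integral_sum[OF dom_A] zero)
  finally show "(LINT \<omega>:A|M. v \<omega> \<bullet> w \<omega>) = 0" .
qed

section \<open>The one-step estimate for the scheme and its two consequences\<close>

theorem proposition1:
  fixes own :: "'n::finite \<Rightarrow> 'p::finite"
    and Xs :: "'p \<Rightarrow> (real ^ 'n) set"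
    and X :: "(real ^ 'n) set"
    and M :: "'w measure"
    and S :: "'p \<Rightarrow> 'z measure"
    and f :: "'p \<Rightarrow> real ^ 'n \<Rightarrow> 'z \<Rightarrow> real"
    and \<xi> :: "'w \<Rightarrow> 'p \<Rightarrow> 'z"
    and Fhat :: "real ^ 'n \<Rightarrow> ('p \<Rightarrow> 'z) \<Rightarrow> real ^ 'n"
    and F :: "real ^ 'n \<Rightarrow> real ^ 'n"
    and \<xi>s :: "nat \<Rightarrow> 'w \<Rightarrow> 'p \<Rightarrow> 'z"
    and x w :: "nat \<Rightarrow> 'w \<Rightarrow> real ^ 'n"
    and \<gamma> :: "nat \<Rightarrow> 'p \<Rightarrow> real"
    and \<delta> \<Gamma> :: "nat \<Rightarrow> real"
    and \<eta> L \<beta> \<nu> :: real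
  assumes prob: "prob_space M"
    and own: "surj own"
    and Xs_sub: "\<forall>i. Xs i \<subseteq> block_space own i"
    and X_def: "X = joint_set own Xs"
    and xi_meas: "\<xi> \<in> M \<rightarrow>\<^sub>M (\<Pi>\<^sub>M i\<in>UNIV. S i)"
    and f_int: "\<forall>i. \<forall>y\<in>X. \<exists>e>0. \<forall>u\<in>block_space own i \<inter> ball (block own i y) e.
                  integrable M (\<lambda>\<omega>. f i (replace_block own i u y) (\<xi> \<omega> i))"
    and f_convex: "\<forall>i. \<forall>y\<in>X. strongly_convex_on (Xs i)
                  (\<lambda>u. \<integral>\<omega>. f i (replace_block own i u y) (\<xi> \<omega> i) \<partial>M)"
    and f_diff: "\<forall>i. \<forall>y\<in>X. \<forall>z\<in>space (S i). block_differentiable own i (\<lambda>v. f i v z) y"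
    and Ef_diff: "\<forall>i. \<forall>y\<in>X. block_differentiable own i (\<lambda>v. \<integral>\<omega>. f i v (\<xi> \<omega> i) \<partial>M) y"
    and Fhat_def: "\<forall>y z. Fhat y z = stacked_gradient own (\<lambda>i v. f i v (z i)) y"
    and F_def: "\<forall>y. F y = stacked_gradient own (\<lambda>i v. \<integral>\<omega>. f i v (\<xi> \<omega> i) \<partial>M) y"
    and Fhat_int: "\<forall>y\<in>X. integrable M (\<lambda>\<omega>. Fhat y (\<xi> \<omega>))"
    and F_eq: "\<forall>y\<in>X. F y = (\<integral>\<omega>. Fhat y (\<xi> \<omega>) \<partial>M)"
    and Fhat_meas: "(\<lambda>(y, z). Fhat y z)
                      \<in> borel_measurable (restrict_space borel X \<Otimes>\<^sub>M (\<Pi>\<^sub>M i\<in>UNIV. S i))"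
    and samples_meas: "\<forall>k. \<xi>s k \<in> M \<rightarrow>\<^sub>M (\<Pi>\<^sub>M i\<in>UNIV. S i)"
    and samples_distr: "\<forall>k. distr M (\<Pi>\<^sub>M i\<in>UNIV. S i) (\<xi>s k) = distr M (\<Pi>\<^sub>M i\<in>UNIV. S i) \<xi>"
    and x0_meas: "x 0 \<in> borel_measurable M"
    and x0_X: "\<forall>\<omega>\<in>space M. x 0 \<omega> \<in> X"
    and x0_indep: "prob_space.indep_set M
                     {x 0 -` A \<inter> space M | A. A \<in> sets borel}
                     {(\<lambda>\<omega> k. \<xi>s k \<omega>) -` B \<inter> space M | B.
                        B \<in> sets (\<Pi>\<^sub>M k\<in>(UNIV::nat set). \<Pi>\<^sub>M i\<in>UNIV. S i)}"
    and x0_int: "integrable M (\<lambda>\<omega>. (norm (x 0 \<omega>))\<^sup>2)"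
    and w_def: "\<forall>k. \<forall>\<omega>\<in>space M. w k \<omega> = Fhat (x k \<omega>) (\<xi>s k \<omega>) - F (x k \<omega>)"
    and x_step: "\<forall>k i. \<forall>\<omega>\<in>space M.
                   block own i (x (Suc k) \<omega>) =
                     closest_point (Xs i)
                       (block own i (x k \<omega>) - \<gamma> k i *\<^sub>R block own i (F (x k \<omega>) + w k \<omega>))"
    and w_int: "\<forall>k. integrable M (w k)"
    and w_mean: "\<forall>k j. AE \<omega> in M.
                   real_cond_exp M (history M (x 0) (\<Pi>\<^sub>M i\<in>UNIV. S i) \<xi>s k) (\<lambda>\<omega>. w k \<omega> $ j) \<omega> = 0"
    and Xs_closed: "\<forall>i. closed (Xs i)"
    and Xs_convex: "\<forall>i. convex (Xs i)"
    and eta: "\<eta> > 0"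
    and F_mono: "strongly_monotone_on \<eta> X F"
    and F_lip: "L-lipschitz_on X F"
    and step_pos: "\<forall>k i. \<gamma> k i > 0"
    and step_sum: "\<forall>i. filterlim (\<lambda>n. \<Sum>k<n. \<gamma> k i) at_top sequentially"
    and step_sq: "\<forall>i. summable (\<lambda>k. (\<gamma> k i)\<^sup>2)"
    and delta: "\<forall>k. \<delta> k > 0 \<and> \<delta> k \<le> (MIN i. \<gamma> k i)"
    and Gamma: "\<forall>k. \<Gamma> k > 0 \<and> \<Gamma> k \<ge> (MAX i. \<gamma> k i)"
    and beta: "0 \<le> \<beta>" "\<beta> < \<eta> / L"
    and ratio: "\<forall>k. (\<Gamma> k - \<delta> k) / \<delta> k \<le> \<beta>"
    and nu: "\<nu> > 0"
    and w_var: "\<forall>k. AE \<omega> in M.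
                  nn_cond_exp M (history M (x 0) (\<Pi>\<^sub>M i\<in>UNIV. S i) \<xi>s k)
                    (\<lambda>\<omega>. ennreal ((norm (w k \<omega>))\<^sup>2)) \<omega> \<le> ennreal (\<nu>\<^sup>2)"
  shows "(\<exists>!xstar. solves_VI X F xstar) \<and>
         (\<forall>xstar. solves_VI X F xstar \<longrightarrow>
            (\<forall>k. integrable M (\<lambda>\<omega>. (norm (x k \<omega> - xstar))\<^sup>2)) \<and>
            (\<forall>k. (\<integral>\<omega>. (norm (x (Suc k) \<omega> - xstar))\<^sup>2 \<partial>M)
                   \<le> (1 + \<beta>)\<^sup>2 * (\<delta> k)\<^sup>2 * \<nu>\<^sup>2
                     + (1 - 2 * (\<eta> - \<beta> * L) * \<delta> k + (1 + \<beta>)\<^sup>2 * L\<^sup>2 * (\<delta> k)\<^sup>2)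
                       * (\<integral>\<omega>. (norm (x k \<omega> - xstar))\<^sup>2 \<partial>M)) \<and>
            (AE \<omega> in M. (\<lambda>k. x k \<omega>) \<longlonglongrightarrow> xstar))"
proof -
  interpret prob_space M by (rule prob)
  let ?B = "\<Pi>\<^sub>M i\<in>UNIV. S i"
  define G where "G = history M (x 0) ?B \<xi>s"
  have "X \<noteq> {}"
    using x0_X not_empty by blast
  then have Xs_ne: "Xs i \<noteq> {}" for i
    unfolding X_def joint_set_def by blast
  have X_cl: "closed X" and X_cv: "convex X"
    unfolding X_def using Xs_closed Xs_convex by (auto intro: closed_joint_set convex_joint_set)
  have "0 \<le> L"
    using F_lip by (rule lipschitz_on_nonneg)
  \<comment> \<open>In HOL \<open>\<eta> / 0 = 0\<close>, so
    \<open>0 \<le> \<beta> < \<eta> / L\<close> excludes \<open>L = 0\<close>.\<close>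
  moreover have "L \<noteq> 0"
    using beta by auto
  ultimately have "0 < L" by simp
  then have margin: "0 < \<eta> - \<beta> * L"
    using beta(2) by (simp add: pos_less_divide_eq)
  have \<delta>_pos: "0 < \<delta> k" for k
    using delta by blast
  have \<delta>_le: "\<delta> k \<le> \<gamma> k i" for k i
  proof -
    have "(MIN i. \<gamma> k i) \<le> \<gamma> k i"
      by (rule Min_le) auto
    then show ?thesis using delta by (meson order_trans)
  qed
  have \<gamma>_le: "\<gamma> k i \<le> (1 + \<beta>) * \<delta> k" for k i
  proof -
    have "\<gamma> k i \<le> (MAX i. \<gamma> k i)"
      by (rule Max_ge) auto
    also have "\<dots> \<le> \<Gamma> k"
      using Gamma by blast
    also have "\<Gamma> k \<le> (1 + \<beta>) * \<delta> k"
      using ratio[rule_format, of k] \<delta>_pos[of k] by (simp add: pos_divide_le_eq algebra_simps)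
    finally show ?thesis .
  qed
  \<comment> \<open>Divergence passes from the stepsizes of any one player to \<delta> because they
    are at most \<open>(1 + \<beta>) * \<delta> k\<close>.\<close>
  have not_summable: "\<not> summable \<delta>"
  proof
    fix i :: 'p
    assume "summable \<delta>"
    then have "summable (\<lambda>k. (1 + \<beta>) * \<delta> k)"
      by (rule summable_mult)
    then have "summable (\<lambda>k. \<gamma> k i)"
      by (rule summable_comparison_test'[where N = 0]) (use step_pos \<gamma>_le in \<open>auto simp: less_imp_le\<close>)
    then have "(\<lambda>n. \<Sum>k<n. \<gamma> k i) \<longlonglongrightarrow> (\<Sum>k. \<gamma> k i)"
      by (rule summable_LIMSEQ)
    moreover have "filterlim (\<lambda>n. \<Sum>k<n. \<gamma> k i) at_infinity sequentially"
      using step_sum by (auto intro: filterlim_at_top_imp_at_infinity)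
    ultimately show False
      using not_tendsto_and_filterlim_at_infinity[OF sequentially_bot] by blast
  qed
  have summable_sq: "summable (\<lambda>k. (\<delta> k)\<^sup>2)"
  proof (rule summable_comparison_test'[where N = 0])
    \<comment> \<open>Here \<open>undefined\<close> is just some player; \<delta> lies below the
      stepsizes of all of them.\<close>
    show "summable (\<lambda>k. (\<gamma> k undefined)\<^sup>2)"
      using step_sq by blast
    show "norm ((\<delta> k)\<^sup>2) \<le> (\<gamma> k undefined)\<^sup>2" for k
      using \<delta>_le[of k undefined] \<delta>_pos[of k] by (simp add: power_mono)
  qed

  have xX: "x k \<omega> \<in> X" if "\<omega> \<in> space M" for k \<omega>
  proof (cases k)
    case 0
    then show ?thesis using x0_X that by simp
  next
    case (Suc m)
    then show ?thesis
      using that x_step Xs_closed Xs_ne by (auto simp: X_def joint_set_def intro: closest_point_in_set)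
  qed

  have sub: "subalgebra M (G k)" for k
    unfolding G_def using x0_meas samples_meas by (intro subalgebra_history) auto
  have G_mono: "sets (G k) \<subseteq> sets (G (Suc k))" for k
    unfolding G_def by (rule history_Suc_mono)
  have space_G: "space (G k) = space M" for k
    by (simp add: G_def)
  have block_meas [measurable]: "block own i \<in> borel_measurable borel" for i
    by (intro borel_measurable_continuous_onI continuous_on_block)
  have stretch_meas [measurable]: "stretch own g \<in> borel_measurable borel" for g
    by (intro borel_measurable_continuous_onI continuous_on_stretch)
  have proj_meas [measurable]: "closest_point (Xs i) \<in> borel_measurable borel" for i
    using Xs_closed Xs_convex Xs_ne by (intro borel_measurable_continuous_onI continuous_on_closest_point) auto
  have x_meas: "x k \<in> borel_measurable (G k)" for k
  proof (induction k)
    case 0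
    show ?case
      unfolding G_def by (rule measurable_history_initial)
  next
    case (Suc k)
    have [measurable]: "x k \<in> borel_measurable (G (Suc k))"
      using Suc.IH G_mono[of k] by (intro measurable_from_subalg[of "G (Suc k)" "G k"]) (auto simp: subalgebra_def space_G)
    have xk: "x k \<in> G (Suc k) \<rightarrow>\<^sub>M restrict_space borel X"
      using xX by (intro measurable_restrict_space2) (auto simp: space_G)
    \<comment> \<open>The sample of iteration \<open>k\<close> enters the history only at index
      \<open>Suc k\<close>: thus \<open>x k\<close> is known from \<open>G k\<close>, while the
      noise \<open>w k\<close> is centred given \<open>G k\<close>.\<close>
    have "\<xi>s k \<in> G (Suc k) \<rightarrow>\<^sub>M ?B"
      unfolding G_def using samples_meas by (intro measurable_history_sample) auto
    from measurable_compose[OF measurable_Pair[OF xk this] Fhat_meas]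
    have [measurable]: "(\<lambda>\<omega>. Fhat (x k \<omega>) (\<xi>s k \<omega>)) \<in> borel_measurable (G (Suc k))"
      by simp
    \<comment> \<open>On \<open>space M\<close> the sum of \<open>F\<close> and the noise is
      \<open>Fhat\<close> at the sample, so the update is expressed by maps already known to be
      measurable for this history.\<close>
    have "x (Suc k) \<in> borel_measurable (G (Suc k)) \<longleftrightarrow>
      (\<lambda>\<omega>. \<Sum>i\<in>UNIV. closest_point (Xs i) (block own i (x k \<omega>) - \<gamma> k i *\<^sub>R block own i (Fhat (x k \<omega>) (\<xi>s k \<omega>))))
        \<in> borel_measurable (G (Suc k))"
    proof (rule measurable_cong)
      fix \<omega> assume "\<omega> \<in> space (G (Suc k))"
      then have \<omega>: "\<omega> \<in> space M" by (simp add: space_G)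
      have "x (Suc k) \<omega> = (\<Sum>i\<in>UNIV. block own i (x (Suc k) \<omega>))"
        by (rule sum_block[symmetric])
      also have "\<dots> = (\<Sum>i\<in>UNIV. closest_point (Xs i) (block own i (x k \<omega>) - \<gamma> k i *\<^sub>R block own i (Fhat (x k \<omega>) (\<xi>s k \<omega>))))"
        using x_step w_def \<omega> by (intro sum.cong refl) simp
      finally show "x (Suc k) \<omega> = (\<Sum>i\<in>UNIV. closest_point (Xs i) (block own i (x k \<omega>) - \<gamma> k i *\<^sub>R block own i (Fhat (x k \<omega>) (\<xi>s k \<omega>))))" .
    qed
    then show ?case
      by simp
  qed
  have w_meas [measurable]: "w k \<in> borel_measurable M" for k
    using w_int by (intro borel_measurable_integrable) simp

  have main: "(\<forall>k. integrable M (\<lambda>\<omega>. (norm (x k \<omega> - z))\<^sup>2)) \<and>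
      (\<forall>k. (\<integral>\<omega>. (norm (x (Suc k) \<omega> - z))\<^sup>2 \<partial>M)
             \<le> (1 + \<beta>)\<^sup>2 * (\<delta> k)\<^sup>2 * \<nu>\<^sup>2
               + (1 - 2 * (\<eta> - \<beta> * L) * \<delta> k + (1 + \<beta>)\<^sup>2 * L\<^sup>2 * (\<delta> k)\<^sup>2)
                 * (\<integral>\<omega>. (norm (x k \<omega> - z))\<^sup>2 \<partial>M)) \<and>
      (AE \<omega> in M. (\<lambda>k. x k \<omega>) \<longlonglongrightarrow> z)"
    if z: "solves_VI X F z" for z
  proof -
    define V where "V = (\<lambda>k \<omega>. (norm (x k \<omega> - z))\<^sup>2)"
    \<comment> \<open>\<open>v k\<close> is the error after a noiseless, unprojected step, relative
      to the same step taken from \<open>z\<close>; \<open>a k\<close> is its contraction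
      factor.\<close>
    define v where "v = (\<lambda>k \<omega>. x k \<omega> - z - stretch own (\<gamma> k) (F (x k \<omega>) - F z))"
    define a where "a = (\<lambda>k. 1 - 2 * (\<eta> - \<beta> * L) * \<delta> k + (1 + \<beta>)\<^sup>2 * L\<^sup>2 * (\<delta> k)\<^sup>2)"
    have zX: "z \<in> X" and VI: "\<And>y. y \<in> X \<Longrightarrow> 0 \<le> (y - z) \<bullet> F z"
      using z by (auto simp: solves_VI_def)
    have zi: "block own i z \<in> Xs i" for i
      using zX by (simp add: X_def joint_set_def)

    \<comment> \<open>Only player \<open>i\<close> deviates from \<open>z\<close>, so the other
      coordinates contribute nothing to the inner product.\<close>
    have block_VI: "0 \<le> (u - block own i z) \<bullet> block own i (F z)" if u: "u \<in> Xs i" for u i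
    proof -
      have "replace_block own i u z \<in> X"
        using zX u Xs_sub unfolding X_def by (intro replace_block_in_joint_set) auto
      from VI[OF this] have "0 \<le> (u - block own i z) \<bullet> F z"
        by (simp add: replace_block_def algebra_simps)
      also have "\<dots> = (u - block own i z) \<bullet> block own i (F z)"
        unfolding inner_vec_def using u Xs_sub by (intro sum.cong refl) (auto simp: block_space_def)
      finally show ?thesis .
    qed
    have z_fix: "closest_point (Xs i) (block own i z - \<gamma> k i *\<^sub>R block own i (F z)) = block own i z" for k i
      using Xs_convex Xs_closed zi step_pos block_VI by (intro closest_point_VI) (auto simp: less_imp_le)

    have v_le: "(norm (v k \<omega>))\<^sup>2 \<le> a k * V k \<omega>" if "\<omega> \<in> space M" for k \<omega>
      unfolding v_def a_def V_def
    proof (rule norm_diff_stretch_le)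
      show "\<eta> * (norm (x k \<omega> - z))\<^sup>2 \<le> (x k \<omega> - z) \<bullet> (F (x k \<omega>) - F z)"
        using F_mono xX[OF that] zX unfolding strongly_monotone_on_def by (subst inner_commute) blast
      show "norm (F (x k \<omega>) - F z) \<le> L * norm (x k \<omega> - z)"
        using lipschitz_onD[OF F_lip xX[OF that] zX] by (simp add: dist_norm)
    qed (use \<delta>_le \<gamma>_le \<delta>_pos beta(1) in \<open>auto simp: less_imp_le\<close>)

    have pathwise: "V (Suc k) \<omega> \<le> a k * V k \<omega> - 2 * (stretch own (\<gamma> k) (v k \<omega>) \<bullet> w k \<omega>)
        + ((1 + \<beta>) * \<delta> k)\<^sup>2 * (norm (w k \<omega>))\<^sup>2" if \<omega>: "\<omega> \<in> space M" for k \<omega>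
    proof -
      let ?w = "stretch own (\<gamma> k) (w k \<omega>)"
      have "V (Suc k) \<omega> = (\<Sum>i\<in>UNIV. (norm (block own i (x (Suc k) \<omega> - z)))\<^sup>2)"
        by (simp only: V_def sum_norm_block)
      also have "\<dots> \<le> (\<Sum>i\<in>UNIV. (norm (block own i (v k \<omega> - ?w)))\<^sup>2)"
      proof (intro sum_mono power_mono norm_ge_zero)
        fix i
        have "norm (block own i (x (Suc k) \<omega> - z)) = dist
            (closest_point (Xs i) (block own i (x k \<omega>) - \<gamma> k i *\<^sub>R block own i (F (x k \<omega>) + w k \<omega>)))
            (closest_point (Xs i) (block own i z - \<gamma> k i *\<^sub>R block own i (F z)))"
          unfolding z_fix dist_norm block_diff using x_step \<omega> by simp
        also have "\<dots> \<le> dist (block own i (x k \<omega>) - \<gamma> k i *\<^sub>R block own i (F (x k \<omega>) + w k \<omega>))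
            (block own i z - \<gamma> k i *\<^sub>R block own i (F z))"
          using Xs_convex Xs_closed Xs_ne by (intro closest_point_lipschitz) auto
        also have "\<dots> = norm (block own i (v k \<omega> - ?w))"
          by (simp add: dist_norm v_def block_diff block_add block_stretch algebra_simps)
        finally show "norm (block own i (x (Suc k) \<omega> - z)) \<le> norm (block own i (v k \<omega> - ?w))" .
      qed
      also have "\<dots> = (norm (v k \<omega> - ?w))\<^sup>2"
        by (rule sum_norm_block)
      \<comment> \<open>By symmetry the stepsizes move from the noise to \<open>v k\<close>, leaving
        the bare noise against a vector known from \<open>G k\<close>.\<close>
      also have "\<dots> = (norm (v k \<omega>))\<^sup>2 - 2 * (stretch own (\<gamma> k) (v k \<omega>) \<bullet> w k \<omega>) + (norm ?w)\<^sup>2"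
        by (simp only: norm_diff_square_eq inner_stretch)
      also have "\<dots> \<le> a k * V k \<omega> - 2 * (stretch own (\<gamma> k) (v k \<omega>) \<bullet> w k \<omega>)
          + ((1 + \<beta>) * \<delta> k)\<^sup>2 * (norm (w k \<omega>))\<^sup>2"
      proof (intro add_mono diff_mono order_refl v_le[OF \<omega>])
        have "norm ?w \<le> (1 + \<beta>) * \<delta> k * norm (w k \<omega>)"
          using step_pos \<gamma>_le by (intro norm_stretch_le) (auto simp: less_imp_le)
        then have "(norm ?w)\<^sup>2 \<le> ((1 + \<beta>) * \<delta> k * norm (w k \<omega>))\<^sup>2"
          by (rule power_mono) simp
        then show "(norm ?w)\<^sup>2 \<le> ((1 + \<beta>) * \<delta> k)\<^sup>2 * (norm (w k \<omega>))\<^sup>2"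
          by (simp only: power_mult_distrib)
      qed
      finally show ?thesis .
    qed

    have V_meas: "V k \<in> borel_measurable (G k)" for k
      unfolding V_def using x_meas[of k] by measurable
    have V_measM [measurable]: "V k \<in> borel_measurable M" for k
      using measurable_from_subalg[OF sub V_meas] .
    have v_meas: "v k \<in> borel_measurable (G k)" for k
    proof -
      have "x k \<in> G k \<rightarrow>\<^sub>M restrict_space borel X"
        using xX x_meas by (intro measurable_restrict_space2) (auto simp: space_G)
      moreover have "F \<in> borel_measurable (restrict_space borel X)"
        using F_lip by (intro borel_measurable_continuous_on_restrict lipschitz_on_continuous_on)
      ultimately have [measurable]: "(\<lambda>\<omega>. F (x k \<omega>)) \<in> borel_measurable (G k)"
        by (rule measurable_compose)
      note x_meas[of k, measurable]
      show ?thesis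
        unfolding v_def by measurable
    qed
    have sv_meas: "(\<lambda>\<omega>. stretch own (\<gamma> k) (v k \<omega>)) \<in> borel_measurable (G k)" for k
      using v_meas[of k] by measurable
    have sv_int: "integrable M (\<lambda>\<omega>. (norm (stretch own (\<gamma> k) (v k \<omega>)))\<^sup>2)" if "integrable M (V k)" for k
    proof (rule Bochner_Integration.integrable_bound)
      show "integrable M (\<lambda>\<omega>. ((1 + \<beta>) * \<delta> k)\<^sup>2 * (a k * V k \<omega>))"
        using that by simp
      show "(\<lambda>\<omega>. (norm (stretch own (\<gamma> k) (v k \<omega>)))\<^sup>2) \<in> borel_measurable M"
        using measurable_from_subalg[OF sub sv_meas[of k]] by measurable
      show "AE \<omega> in M. norm ((norm (stretch own (\<gamma> k) (v k \<omega>)))\<^sup>2) \<le> norm (((1 + \<beta>) * \<delta> k)\<^sup>2 * (a k * V k \<omega>))"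
      proof (rule AE_I2)
        fix \<omega> assume \<omega>: "\<omega> \<in> space M"
        have "norm (stretch own (\<gamma> k) (v k \<omega>)) \<le> (1 + \<beta>) * \<delta> k * norm (v k \<omega>)"
          using step_pos \<gamma>_le by (intro norm_stretch_le) (auto simp: less_imp_le)
        then have "(norm (stretch own (\<gamma> k) (v k \<omega>)))\<^sup>2 \<le> ((1 + \<beta>) * \<delta> k * norm (v k \<omega>))\<^sup>2"
          by (rule power_mono) simp
        also have "\<dots> = ((1 + \<beta>) * \<delta> k)\<^sup>2 * (norm (v k \<omega>))\<^sup>2"
          by (rule power_mult_distrib)
        also have "\<dots> \<le> ((1 + \<beta>) * \<delta> k)\<^sup>2 * (a k * V k \<omega>)"
          by (intro mult_left_mono v_le[OF \<omega>]) simp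
        finally show "norm ((norm (stretch own (\<gamma> k) (v k \<omega>)))\<^sup>2) \<le> norm (((1 + \<beta>) * \<delta> k)\<^sup>2 * (a k * V k \<omega>))"
          by simp
      qed
    qed
    note noise = noise_moments[OF sub _ sv_meas sv_int w_meas w_mean[rule_format, folded G_def] w_var[rule_format, folded G_def]]
    have space_in_G: "space M \<in> sets (G k)" for k
      using sets.top[of "G k"] by (simp add: space_G)

    \<comment> \<open>The noise moments at time \<open>k\<close> require the squared error to be
      integrable at that time, so integrability has to be carried along the iteration; the pathwise
      bound supplies the dominating function.\<close>
    have V_int: "integrable M (V k)" for k
    proof (induction k)
      case 0
      show ?case
      proof (rule Bochner_Integration.integrable_bound)
        show "integrable M (\<lambda>\<omega>. 2 * (norm (x 0 \<omega>))\<^sup>2 + 2 * (norm z)\<^sup>2)"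
          using x0_int by simp
        show "V 0 \<in> borel_measurable M"
          by measurable
        show "AE \<omega> in M. norm (V 0 \<omega>) \<le> norm (2 * (norm (x 0 \<omega>))\<^sup>2 + 2 * (norm z)\<^sup>2)"
        proof (rule AE_I2)
          fix \<omega>
          have "V 0 \<omega> \<le> (norm (x 0 \<omega>) + norm z)\<^sup>2"
            unfolding V_def by (intro power_mono norm_triangle_ineq4) simp
          also have "\<dots> \<le> 2 * (norm (x 0 \<omega>))\<^sup>2 + 2 * (norm z)\<^sup>2"
            using sum_squares_bound[of "norm (x 0 \<omega>)" "norm z"] by (simp add: power2_sum)
          finally show "norm (V 0 \<omega>) \<le> norm (2 * (norm (x 0 \<omega>))\<^sup>2 + 2 * (norm z)\<^sup>2)"
            by (simp add: V_def)
        qed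
      qed
    next
      case (Suc k)
      show ?case
      proof (rule Bochner_Integration.integrable_bound)
        show "integrable M (\<lambda>\<omega>. a k * V k \<omega> - 2 * (stretch own (\<gamma> k) (v k \<omega>) \<bullet> w k \<omega>)
            + ((1 + \<beta>) * \<delta> k)\<^sup>2 * (norm (w k \<omega>))\<^sup>2)"
          using Suc.IH noise(1,3)[OF space_in_G Suc.IH]
          by (intro Bochner_Integration.integrable_add Bochner_Integration.integrable_diff integrable_mult_right)
        show "AE \<omega> in M. norm (V (Suc k) \<omega>) \<le> norm (a k * V k \<omega>
            - 2 * (stretch own (\<gamma> k) (v k \<omega>) \<bullet> w k \<omega>) + ((1 + \<beta>) * \<delta> k)\<^sup>2 * (norm (w k \<omega>))\<^sup>2)"
        proof (rule AE_I2)
          fix \<omega> assume "\<omega> \<in> space M"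
          have "norm (V (Suc k) \<omega>) = V (Suc k) \<omega>"
            by (simp add: V_def)
          also note pathwise[OF \<open>\<omega> \<in> space M\<close>]
          also note abs_ge_self
          finally show "norm (V (Suc k) \<omega>) \<le> norm (a k * V k \<omega>
            - 2 * (stretch own (\<gamma> k) (v k \<omega>) \<bullet> w k \<omega>) + ((1 + \<beta>) * \<delta> k)\<^sup>2 * (norm (w k \<omega>))\<^sup>2)"
            by simp
        qed
      qed measurable
    qed

    \<comment> \<open>The conditional one-step estimate in integrated form. The cross term vanishes
      on each event of the history.\<close>
    have step: "(LINT \<omega>:A|M. V (Suc k) \<omega>) \<le> a k * (LINT \<omega>:A|M. V k \<omega>) + (1 + \<beta>)\<^sup>2 * (\<delta> k)\<^sup>2 * \<nu>\<^sup>2 * prob A"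
      if A: "A \<in> sets (G k)" for A k
    proof -
      note moments = noise[OF A V_int]
      have AM: "A \<in> sets M"
        using A sub by (auto simp: subalgebra_def)
      have si: "set_integrable M A f" if "integrable M f" for f :: "'w \<Rightarrow> real"
        unfolding set_integrable_def using AM that by (rule integrable_mult_indicator)
      have "(LINT \<omega>:A|M. V (Suc k) \<omega>) \<le> (LINT \<omega>:A|M. a k * V k \<omega>
          - 2 * (stretch own (\<gamma> k) (v k \<omega>) \<bullet> w k \<omega>) + ((1 + \<beta>) * \<delta> k)\<^sup>2 * (norm (w k \<omega>))\<^sup>2)"
      proof (intro set_integral_mono si)
        show "V (Suc k) \<omega> \<le> a k * V k \<omega> - 2 * (stretch own (\<gamma> k) (v k \<omega>) \<bullet> w k \<omega>)
            + ((1 + \<beta>) * \<delta> k)\<^sup>2 * (norm (w k \<omega>))\<^sup>2" if "\<omega> \<in> A" for \<omega>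
          using pathwise sets.sets_into_space[OF AM] that by blast
      qed (use V_int moments in simp_all)
      also have "\<dots> = a k * (LINT \<omega>:A|M. V k \<omega>) - 2 * (LINT \<omega>:A|M. stretch own (\<gamma> k) (v k \<omega>) \<bullet> w k \<omega>)
          + ((1 + \<beta>) * \<delta> k)\<^sup>2 * (LINT \<omega>:A|M. (norm (w k \<omega>))\<^sup>2)"
        using V_int moments(1,3)
        by (simp add: set_integral_add set_integral_diff si)
      also have "\<dots> \<le> a k * (LINT \<omega>:A|M. V k \<omega>) + ((1 + \<beta>) * \<delta> k)\<^sup>2 * (\<nu>\<^sup>2 * prob A)"
        unfolding moments(4) using moments(2) by (simp add: mult_left_mono)
      finally show ?thesis
        by (simp add: power_mult_distrib mult.assoc)
    qed

    have "AE \<omega> in M. (\<lambda>k. V k \<omega>) \<longlonglongrightarrow> 0"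
    \<comment> \<open>The factor \<open>a k\<close> is split into its linear part \<open>d\<close>,
      not summable and nonnegative because \<open>\<beta> * L < \<eta>\<close>, and its quadratic
      part \<open>p\<close>, summable like the noise term \<open>q\<close>.\<close>
    proof (rule almost_supermartingale_AE_null[where G = G and V = V
          and d = "\<lambda>k. 2 * (\<eta> - \<beta> * L) * \<delta> k" and p = "\<lambda>k. (1 + \<beta>)\<^sup>2 * L\<^sup>2 * (\<delta> k)\<^sup>2"
          and q = "\<lambda>k. (1 + \<beta>)\<^sup>2 * (\<delta> k)\<^sup>2 * \<nu>\<^sup>2", OF sub G_mono V_meas V_int])
      show "0 \<le> V k \<omega>" for k \<omega>
        by (simp add: V_def)
      show "0 \<le> 2 * (\<eta> - \<beta> * L) * \<delta> k" for k
        using margin \<delta>_pos[of k] by simp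
      show "\<not> summable (\<lambda>k. 2 * (\<eta> - \<beta> * L) * \<delta> k)"
        using margin not_summable by (subst summable_cmult_iff) auto
      show "summable (\<lambda>k. (1 + \<beta>)\<^sup>2 * L\<^sup>2 * (\<delta> k)\<^sup>2)" "summable (\<lambda>k. (1 + \<beta>)\<^sup>2 * (\<delta> k)\<^sup>2 * \<nu>\<^sup>2)"
        by (intro summable_mult summable_mult2 summable_sq)+
      show "(LINT \<omega>:A|M. V (Suc k) \<omega>) \<le>
          (1 + (1 + \<beta>)\<^sup>2 * L\<^sup>2 * (\<delta> k)\<^sup>2 - 2 * (\<eta> - \<beta> * L) * \<delta> k) * (LINT \<omega>:A|M. V k \<omega>)
          + (1 + \<beta>)\<^sup>2 * (\<delta> k)\<^sup>2 * \<nu>\<^sup>2 * prob A" if "A \<in> sets (G k)" for k A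
      proof -
        have "a k = 1 + (1 + \<beta>)\<^sup>2 * L\<^sup>2 * (\<delta> k)\<^sup>2 - 2 * (\<eta> - \<beta> * L) * \<delta> k"
          by (simp add: a_def)
        with step[OF that] show ?thesis by simp
      qed
    qed simp_all
    then have "AE \<omega> in M. (\<lambda>k. x k \<omega>) \<longlonglongrightarrow> z"
    proof eventually_elim
      case (elim \<omega>)
      have "(\<lambda>k. sqrt (V k \<omega>)) \<longlonglongrightarrow> sqrt 0"
        using elim by (rule tendsto_real_sqrt)
      then have "(\<lambda>k. norm (x k \<omega> - z)) \<longlonglongrightarrow> 0"
        by (simp add: V_def)
      then show ?case
        by (simp add: LIM_zero_iff tendsto_norm_zero_iff)
    qed
    \<comment> \<open>Claim (a) is \<open>step\<close> on the sure event, where the probability is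
      1.\<close>
    moreover have "expectation (V (Suc k)) \<le> (1 + \<beta>)\<^sup>2 * (\<delta> k)\<^sup>2 * \<nu>\<^sup>2 + a k * expectation (V k)" for k
      using step[OF space_in_G[of k]] by (simp add: set_integral_space V_int prob_space add.commute)
    ultimately show ?thesis
      using V_int unfolding V_def a_def by blast
  qed
  have "\<exists>!z. solves_VI X F z"
    using solves_VI_exists[OF X_cv X_cl \<open>X \<noteq> {}\<close> F_mono eta F_lip] solves_VI_unique[OF F_mono eta] by blast
  with main show ?thesis by blast
qed

end
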